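(* Let $N\ge 2$, let $B_1\subset\mathbb{R}^N$ be the unit ball centered at the origin, and let $p\in(1,p_N)$, where $p_N=+\infty$ if $N=2$ and $p_N=\frac{N}{N-2}$ if $N\ge 3$. Then the Emden problem $$-\Delta u_0=u_0^p\ \text{in }B_1,\qquad u_0>0\ \text{in }B_1,\qquad u_0=0\ \text{on }\partial B_1$$ admits a unique solution.
   Context: Solutions are understood in the classical sense. *)

theory Defs
  imports "HOL-Analysis.Analysis" "HOL-Library.Extended_Real"
begin

(* Meaningful only where f is differentiable; C1_on below ensures this. *)
definition partial_deriv :: "'n \<Rightarrow> (real ^ 'n::finite \<Rightarrow> real) \<Rightarrow> real ^ 'n \<Rightarrow> real" where
  "partial_deriv i f x = frechet_derivative f (at x) (axis i 1)"

(* Intended for open S: derivatives are taken in the full space. *)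
definition C1_on :: "(real ^ 'n::finite) set \<Rightarrow> (real ^ 'n \<Rightarrow> real) \<Rightarrow> bool" where
  "C1_on S f \<longleftrightarrow>
     (\<forall>x\<in>S. f differentiable (at x)) \<and> (\<forall>i. continuous_on S (partial_deriv i f))"

definition C2_on :: "(real ^ 'n::finite) set \<Rightarrow> (real ^ 'n \<Rightarrow> real) \<Rightarrow> bool" where
  "C2_on S f \<longleftrightarrow> C1_on S f \<and> (\<forall>i. C1_on S (partial_deriv i f))"

definition laplacian :: "(real ^ 'n::finite \<Rightarrow> real) \<Rightarrow> real ^ 'n \<Rightarrow> real" where
  "laplacian f x = (\<Sum>i\<in>UNIV. partial_deriv i (partial_deriv i f) x)"

definition critical_exponent :: "nat \<Rightarrow> ereal" where
  "critical_exponent N = (if N = 2 then \<infinity> else ereal (real N / (real N - 2)))"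

(* A classical solution is an element of C^2(B_1) that is continuous up to the boundary.
   A function on the closed ball is encoded as a total function; only its values on
   cball 0 1 matter. *)
definition emden_solution :: "real \<Rightarrow> (real ^ 'n::finite \<Rightarrow> real) \<Rightarrow> bool" where
  "emden_solution p u \<longleftrightarrow>
     C2_on (ball 0 1) u \<and> continuous_on (cball 0 1) u \<and>
     (\<forall>x\<in>ball 0 1. - laplacian u x = u x powr p) \<and>
     (\<forall>x\<in>ball 0 1. u x > 0) \<and>
     (\<forall>x\<in>sphere 0 1. u x = 0)"

end

(* By the method of moving planes a solution u is dominated, on each cap cut off by a plane, by its
   reflection in that plane; at the planes through the origin this gives symmetry in every
   direction, so u is radial. Its profile solves v'' + (N-1)/r v' + v^p = 0, v'(0) = 0. Solutions of
   this initial value problem are determined by v(0), and the scaling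
   v(r) -> m^(2/(p-1)) v(m r) maps solutions to solutions, so the condition v(1) = 0 leaves only one.
   Conversely, the solution with v(0) = 1 exists by Picard iteration. While it is positive it is
   O(r^(-2/(p-1))) and at least c r^(2-N), which for p < N/(N-2) is impossible for large r. So it has
   a first zero R, and scaling by R gives a solution in the unit ball. *)

theory Submission
  imports Defs
begin

section \<open>Pointwise Laplacians\<close>

text \<open>Every comparison rests on one fact: at an interior local minimum the pointwise Laplacian
  is nonnegative. The strong minimum principle, the moving plane step and even the uniqueness of the
  Laplacian follow from it, the first two with explicit barriers. Domination is a one-sided
  inequality; for planes through the origin, equality comes from exchanging two points, that is,
  from using both \<open>e\<close> and \<open>- e\<close>. In the radial equation the coefficient
  (N-1)/r is singular at the centre. The divergence form (r^(N-1) v')' = - r^(N-1) v^p removes the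
  singularity: it gives the integral equation for the iteration, the second derivative of the
  profile at the centre, and both decay rates. These collide when 2/(p-1) > N-2, which is p <
  N/(N-2) for N >= 3 and always true for N = 2. The power is first replaced by a bounded Lipschitz
  function, so that the iteration converges on an interval of prescribed length and no local
  solution has to be continued.\<close>

text \<open>Reading the Laplacian as the trace of the derivative of the gradient makes its
  invariance under orthogonal maps a statement about traces.\<close>

definition has_lap :: "(real ^ 'n::finite \<Rightarrow> real) \<Rightarrow> real ^ 'n \<Rightarrow> real \<Rightarrow> bool" where
  "has_lap f x L \<longleftrightarrow>
     (\<exists>G H. (\<forall>\<^sub>F y in nhds x. (f has_derivative (\<lambda>h. G y \<bullet> h)) (at y)) \<and>
            (G has_derivative H) (at x) \<and> L = trace (matrix H))"

lemma has_lapI: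
  assumes "open S" "x \<in> S"
    and "\<And>y. y \<in> S \<Longrightarrow> (f has_derivative (\<lambda>h. G y \<bullet> h)) (at y)"
    and "(G has_derivative H) (at x)" and "L = trace (matrix H)"
  shows "has_lap f x L"
  unfolding has_lap_def eventually_nhds using assms by blast

lemma has_lapI_eventually:
  assumes "\<forall>\<^sub>F y in nhds x. (f has_derivative (\<lambda>h. G y \<bullet> h)) (at y)"
    and "(G has_derivative H) (at x)" and "L = trace (matrix H)"
  shows "has_lap f x L"
  unfolding has_lap_def using assms by blast

lemma trace_matrix: "trace (matrix H) = (\<Sum>i\<in>UNIV. H (axis i 1) $ i)"
  by (simp add: trace_def matrix_def)

lemma has_derivative_vec_lambda_iff:
  fixes F :: "real ^ 'n::finite \<Rightarrow> real ^ 'n"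
  shows "(F has_derivative F') (at x within S) \<longleftrightarrow>
    (\<forall>i. ((\<lambda>y. F y $ i) has_derivative (\<lambda>h. F' h $ i)) (at x within S))"
  by (subst has_derivative_componentwise_within)
     (auto simp: Basis_vec_def cart_eq_inner_axis)

lemma C1_on_has_derivative:
  assumes "C1_on S f" "x \<in> S"
  shows "(f has_derivative (\<lambda>h. (\<chi> i. partial_deriv i f x) \<bullet> h)) (at x)"
proof -
  let ?D = "frechet_derivative f (at x)"
  have d: "(f has_derivative ?D) (at x)"
    using assms unfolding C1_on_def by (simp add: frechet_derivative_works)
  then have lin: "linear ?D" by (rule has_derivative_linear)
  have "?D h = (\<chi> i. partial_deriv i f x) \<bullet> h" for h
  proof -
    have "h = (\<Sum>i\<in>UNIV. (h $ i) *\<^sub>R axis i 1)"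
      using basis_expansion[of h] by (simp add: scalar_mult_eq_scaleR)
    then have "?D h = ?D (\<Sum>i\<in>UNIV. (h $ i) *\<^sub>R axis i 1)"
      by (rule arg_cong)
    also have "\<dots> = (\<Sum>i\<in>UNIV. (h $ i) *\<^sub>R ?D (axis i 1))"
      by (simp add: linear_sum[OF lin] linear_scale[OF lin])
    also have "\<dots> = (\<chi> i. partial_deriv i f x) \<bullet> h"
      by (simp add: inner_vec_def partial_deriv_def mult.commute)
    finally show ?thesis .
  qed
  then have "?D = (\<lambda>h. (\<chi> i. partial_deriv i f x) \<bullet> h)" by blast
  with d show ?thesis by simp
qed

lemma C2_on_hessian:
  fixes f :: "real ^ 'n::finite \<Rightarrow> real"
  assumes C2: "C2_on S f"
  defines "G \<equiv> (\<lambda>y. \<chi> i. partial_deriv i f y)"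
    and "H \<equiv> (\<lambda>x h. \<chi> i. (\<chi> j. partial_deriv j (partial_deriv i f) x) \<bullet> h)"
  assumes x: "x \<in> S"
  shows "(f has_derivative (\<lambda>h. G x \<bullet> h)) (at x)" and "(G has_derivative H x) (at x)"
    and "laplacian f x = trace (matrix (H x))"
proof -
  show "(f has_derivative (\<lambda>h. G x \<bullet> h)) (at x)"
    unfolding G_def using C2 x by (auto simp: C2_on_def intro: C1_on_has_derivative)
  show "(G has_derivative H x) (at x)"
    unfolding has_derivative_vec_lambda_iff G_def H_def
    using C2 x by (auto simp: C2_on_def intro: C1_on_has_derivative)
  show "laplacian f x = trace (matrix (H x))"
    by (simp add: trace_matrix laplacian_def inner_axis H_def)
qed

lemma C2_on_has_lap:
  assumes C2: "C2_on S f" and S: "open S" "x \<in> S"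
  shows "has_lap f x (laplacian f x)"
  by (rule has_lapI[OF S C2_on_hessian[OF C2]]) (use S in auto)

text \<open>The converse of \<open>C2_on_hessian\<close>, used to recognise the constructed radial
  function as a classical solution. The columns \<open>H x (axis j 1)\<close> carry all second
  partial derivatives, so continuity is asked of them alone.\<close>

lemma C2_onI:
  fixes f :: "real ^ 'n::finite \<Rightarrow> real"
  assumes S: "open S"
    and G: "\<And>x. x \<in> S \<Longrightarrow> (f has_derivative (\<lambda>h. G x \<bullet> h)) (at x)"
    and H: "\<And>x. x \<in> S \<Longrightarrow> (G has_derivative H x) (at x)"
    and cont: "\<And>j. continuous_on S (\<lambda>x. H x (axis j 1))"
  shows "C2_on S f" and "\<And>x. x \<in> S \<Longrightarrow> laplacian f x = trace (matrix (H x))"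
proof -
  have p: "partial_deriv i f x = G x $ i" if "x \<in> S" for i x
    using frechet_derivative_at[OF G[OF that], symmetric]
    by (simp add: partial_deriv_def inner_axis)
  have Hi: "((\<lambda>y. G y $ i) has_derivative (\<lambda>h. H x h $ i)) (at x)" if "x \<in> S" for i x
    using H[OF that] unfolding has_derivative_vec_lambda_iff by blast
  have Hp: "(partial_deriv i f has_derivative (\<lambda>h. H x h $ i)) (at x)" if "x \<in> S" for i x
    by (rule has_derivative_transform_within_open[OF Hi[OF that] S that]) (simp add: p)
  have pp: "partial_deriv j (partial_deriv i f) x = H x (axis j 1) $ i" if "x \<in> S" for i j x
    using frechet_derivative_at[OF Hp[OF that], symmetric] by (simp add: partial_deriv_def)
  have Gc: "continuous_on S G"
    using H by (meson continuous_at_imp_continuous_on has_derivative_continuous)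
  have "C1_on S f"
    unfolding C1_on_def
  proof (intro conjI allI ballI)
    show "f differentiable at x" if "x \<in> S" for x using G[OF that] differentiableI by blast
    show "continuous_on S (partial_deriv i f)" for i
      by (rule continuous_on_eq[where f = "\<lambda>x. G x $ i"])
         (auto simp: p intro: continuous_intros Gc)
  qed
  moreover have "C1_on S (partial_deriv i f)" for i
    unfolding C1_on_def
  proof (intro conjI allI ballI)
    show "partial_deriv i f differentiable at x" if "x \<in> S" for x
      using Hp[OF that] differentiableI by blast
    show "continuous_on S (partial_deriv j (partial_deriv i f))" for j
      by (rule continuous_on_eq[where f = "\<lambda>x. H x (axis j 1) $ i"])
         (auto simp: pp intro: continuous_intros cont)
  qed
  ultimately show "C2_on S f" unfolding C2_on_def by blast
  show "laplacian f x = trace (matrix (H x))" if "x \<in> S" for x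
    by (simp add: laplacian_def trace_matrix pp[OF that])
qed

section \<open>Trace identities and operations that preserve pointwise Laplacians\<close>

lemma trace_matrix_add:
  "trace (matrix (\<lambda>h. F h + G h)) = trace (matrix F) + trace (matrix G)"
  by (simp add: trace_matrix sum.distrib)

lemma trace_matrix_scale:
  fixes F :: "real ^ 'n::finite \<Rightarrow> real ^ 'n"
  shows "trace (matrix (\<lambda>h. c *\<^sub>R F h)) = c * trace (matrix F)"
  by (simp add: trace_matrix sum_distrib_left)

lemma trace_matrix_rank1:
  fixes v w :: "real ^ 'n::finite"
  shows "trace (matrix (\<lambda>h. (v \<bullet> h) *\<^sub>R w)) = v \<bullet> w"
  by (simp add: trace_matrix inner_axis inner_vec_def[of v w])

lemma trace_matrix_ident:
  "trace (matrix (\<lambda>h::real ^ 'n::finite. h)) = real CARD('n)"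
  by (simp add: trace_matrix)

lemma has_lap_add:
  assumes "has_lap f x L" "has_lap g x M"
  shows "has_lap (\<lambda>y. f y + g y) x (L + M)"
proof -
  obtain G H where G: "\<forall>\<^sub>F y in nhds x. (f has_derivative (\<lambda>h. G y \<bullet> h)) (at y)"
    "(G has_derivative H) (at x)" "L = trace (matrix H)"
    using assms(1) unfolding has_lap_def by blast
  obtain G' H' where G': "\<forall>\<^sub>F y in nhds x. (g has_derivative (\<lambda>h. G' y \<bullet> h)) (at y)"
    "(G' has_derivative H') (at x)" "M = trace (matrix H')"
    using assms(2) unfolding has_lap_def by blast
  have "\<forall>\<^sub>F y in nhds x. ((\<lambda>y. f y + g y) has_derivative (\<lambda>h. (G y + G' y) \<bullet> h)) (at y)"
    using G(1) G'(1) by eventually_elim (auto intro!: derivative_eq_intros simp: inner_add_left)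
  moreover have "((\<lambda>y. G y + G' y) has_derivative (\<lambda>h. H h + H' h)) (at x)"
    using G(2) G'(2) by (rule has_derivative_add)
  ultimately show ?thesis
    by (rule has_lapI_eventually) (simp add: G(3) G'(3) trace_matrix_add)
qed

lemma has_lap_cmult:
  assumes "has_lap f x L"
  shows "has_lap (\<lambda>y. c * f y) x (c * L)"
proof -
  obtain G H where G: "\<forall>\<^sub>F y in nhds x. (f has_derivative (\<lambda>h. G y \<bullet> h)) (at y)"
    "(G has_derivative H) (at x)" "L = trace (matrix H)"
    using assms unfolding has_lap_def by blast
  have "\<forall>\<^sub>F y in nhds x. ((\<lambda>y. c * f y) has_derivative (\<lambda>h. (c *\<^sub>R G y) \<bullet> h)) (at y)"
    using G(1) by eventually_elim (auto intro!: derivative_eq_intros)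
  moreover have "((\<lambda>y. c *\<^sub>R G y) has_derivative (\<lambda>h. c *\<^sub>R H h)) (at x)"
    using G(2) by (rule has_derivative_scaleR_right)
  ultimately show ?thesis
    by (rule has_lapI_eventually) (simp add: G(3) trace_matrix_scale)
qed

lemma has_lap_diff:
  assumes "has_lap f x L" "has_lap g x M"
  shows "has_lap (\<lambda>y. f y - g y) x (L - M)"
  using has_lap_add[OF assms(1) has_lap_cmult[OF assms(2), of "-1"]] by simp

lemma has_lap_const: "has_lap (\<lambda>y. c) x 0"
  by (rule has_lapI[of UNIV _ _ "\<lambda>y. 0" "\<lambda>h. 0"]) (auto simp: trace_matrix)

lemma has_lap_transform:
  assumes L: "has_lap f x L" and S: "open S" "x \<in> S" and eq: "\<And>y. y \<in> S \<Longrightarrow> f y = g y"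
  shows "has_lap g x L"
proof -
  obtain G H where G: "\<forall>\<^sub>F y in nhds x. (f has_derivative (\<lambda>h. G y \<bullet> h)) (at y)"
    "(G has_derivative H) (at x)" "L = trace (matrix H)"
    using L unfolding has_lap_def by blast
  have "\<forall>\<^sub>F y in nhds x. (g has_derivative (\<lambda>h. G y \<bullet> h)) (at y)"
    using G(1) eventually_nhds_in_open[OF S]
    by eventually_elim (erule has_derivative_transform_within_open[OF _ S(1)], auto simp: eq)
  from has_lapI_eventually[OF this G(2,3)] show ?thesis .
qed

lemma linear_matrix_apply:
  fixes f :: "real ^ 'n::finite \<Rightarrow> real ^ 'm::finite"
  shows "linear f \<Longrightarrow> matrix f *v x = f x"
  using matrix_vector_mul(2)[THEN fun_cong] by (simp add: linear_conv_bounded_linear)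

text \<open>The gradient of the composition is \<open>transpose Q\<close> applied to the old
  gradient, so its derivative is \<open>H\<close> conjugated by \<open>Q\<close>. The trace is
  cyclic, and the two orthogonal factors cancel.\<close>

lemma has_lap_orthogonal:
  fixes Q :: "real ^ 'n::finite ^ 'n"
  assumes Q: "orthogonal_matrix Q" and L: "has_lap f (a + Q *v x) L"
  shows "has_lap (\<lambda>y. f (a + Q *v y)) x L"
proof -
  let ?T = "\<lambda>y. a + Q *v y"
  obtain G H where G: "\<forall>\<^sub>F y in nhds (?T x). (f has_derivative (\<lambda>h. G y \<bullet> h)) (at y)"
    "(G has_derivative H) (at (?T x))" "L = trace (matrix H)"
    using L unfolding has_lap_def by blast
  have bl: "bounded_linear ((*v) Q)" by (simp add: matrix_vector_mul_bounded_linear)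
  have dT: "(?T has_derivative (\<lambda>h. Q *v h)) (at y)" for y
    by (auto intro!: derivative_eq_intros bounded_linear.has_derivative[OF bl])
  have "filterlim ?T (nhds (?T x)) (nhds x)"
    using has_derivative_continuous[OF dT, of x]
    by (simp add: isCont_def tendsto_nhds_iff)
  then have "\<forall>\<^sub>F y in nhds x. (f has_derivative (\<lambda>h. G (?T y) \<bullet> h)) (at (?T y))"
    using G(1) unfolding filterlim_iff by blast
  then have 1: "\<forall>\<^sub>F y in nhds x.
      ((\<lambda>y. f (?T y)) has_derivative (\<lambda>h. (transpose Q *v G (?T y)) \<bullet> h)) (at y)"
  proof eventually_elim
    case (elim y)
    have "((\<lambda>y. f (?T y)) has_derivative (\<lambda>h. G (?T y) \<bullet> (Q *v h))) (at y)"
      by (rule has_derivative_compose[OF dT elim])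
    then show ?case by (simp only: dot_lmul_matrix transpose_matrix_vector)
  qed
  have blT: "bounded_linear ((*v) (transpose Q))" by (simp add: matrix_vector_mul_bounded_linear)
  have linH: "linear H" using G(2) by (rule has_derivative_linear)
  have 2: "((\<lambda>y. transpose Q *v G (?T y)) has_derivative (\<lambda>h. transpose Q *v H (Q *v h))) (at x)"
    by (rule bounded_linear.has_derivative[OF blT has_derivative_compose[OF dT G(2)]])
  have "matrix (\<lambda>h. transpose Q *v H (Q *v h)) = transpose Q ** (matrix H ** Q)"
  proof -
    have "(\<lambda>h. transpose Q *v H (Q *v h)) = (*v) (transpose Q ** (matrix H ** Q))"
      by (rule ext) (simp add: matrix_vector_mul_assoc[symmetric] linear_matrix_apply[OF linH])
    then show ?thesis by (simp add: matrix_of_matrix_vector_mul)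
  qed
  moreover have "trace (transpose Q ** (matrix H ** Q)) = trace (matrix H)"
    using Q by (subst trace_mul_sym)
      (simp add: orthogonal_matrix_def matrix_mul_assoc[symmetric])
  ultimately have "L = trace (matrix (\<lambda>h. transpose Q *v H (Q *v h)))"
    using G(3) by simp
  with 1 2 show ?thesis by (rule has_lapI_eventually)
qed

text \<open>For a unit vector \<open>e\<close> this is the mirror image in the hyperplane
  \<open>x \<bullet> e = c\<close>.\<close>

definition reflect :: "'a::real_inner \<Rightarrow> real \<Rightarrow> 'a \<Rightarrow> 'a" where
  "reflect e c x = x - (2 * (x \<bullet> e - c)) *\<^sub>R e"

lemma has_lap_reflect:
  fixes e :: "real ^ 'n::finite"
  assumes e: "norm e = 1" and L: "has_lap f (reflect e c x) L"
  shows "has_lap (\<lambda>y. f (reflect e c y)) x L"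
proof -
  let ?A = "\<lambda>y. y - (2 * (y \<bullet> e)) *\<^sub>R e"
  have ee: "e \<bullet> e = 1" using e by (simp add: norm_eq_1)
  have lin: "linear ?A"
    by (rule linearI) (auto simp: algebra_simps scaleR_add_left inner_add_left)
  have "orthogonal_transformation ?A"
    unfolding orthogonal_transformation_def
    using lin ee by (auto simp: algebra_simps inner_commute)
  then have Q: "orthogonal_matrix (matrix ?A)"
    by (simp add: orthogonal_transformation_matrix)
  have R: "reflect e c y = (2 * c) *\<^sub>R e + matrix ?A *v y" for y
    unfolding linear_matrix_apply[OF lin] by (simp add: reflect_def algebra_simps)
  show ?thesis
    using has_lap_orthogonal[OF Q, of f "(2 * c) *\<^sub>R e" x L] L unfolding R by simp
qed

text \<open>Each diagonal entry of the Hessian is nonnegative by itself. Second derivatives exist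
  only at \<open>x\<close>, so instead of a Taylor expansion the sign of the first derivative along
  an axis is used: it vanishes at the minimum, and a negative second derivative would make it
  negative just afterwards, forcing \<open>f\<close> below \<open>f x\<close>.\<close>

lemma has_lap_local_min:
  fixes f :: "real ^ 'n::finite \<Rightarrow> real"
  assumes L: "has_lap f x L" and S: "open S" "x \<in> S" and min: "\<And>y. y \<in> S \<Longrightarrow> f x \<le> f y"
  shows "L \<ge> 0"
proof -
  obtain G H where G: "\<forall>\<^sub>F y in nhds x. (f has_derivative (\<lambda>h. G y \<bullet> h)) (at y)"
    "(G has_derivative H) (at x)" "L = trace (matrix H)"
    using L unfolding has_lap_def by blast
  obtain U where U: "open U" "x \<in> U" "\<And>y. y \<in> U \<Longrightarrow> (f has_derivative (\<lambda>h. G y \<bullet> h)) (at y)"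
    using G(1) unfolding eventually_nhds by blast
  obtain r where r: "r > 0" "ball x r \<subseteq> S \<inter> U"
    using S U(1,2) by (meson IntI open_Int open_contains_ball)
  have "0 \<le> H (axis i 1) $ i" for i
  proof (rule ccontr)
    assume neg: "\<not> 0 \<le> H (axis i 1) $ i"
    let ?e = "axis i 1 :: real ^ 'n"
    let ?l = "\<lambda>t. x + t *\<^sub>R ?e"
    let ?d = "\<lambda>t. G (?l t) \<bullet> ?e"
    have dl: "(?l has_derivative (\<lambda>t. t *\<^sub>R ?e)) (at t)" for t
      by (auto intro!: derivative_eq_intros)
    have inb: "?l t \<in> ball x r" if "\<bar>t\<bar> < r" for t
      using that by (simp add: dist_norm)
    have d1: "((\<lambda>t. f (?l t)) has_real_derivative ?d t) (at t)" if t: "\<bar>t\<bar> < r" for t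
    proof -
      have "(f has_derivative (\<lambda>h. G (?l t) \<bullet> h)) (at (?l t))"
        using inb[OF t] r U(3) by blast
      from has_derivative_compose[OF dl this] show ?thesis
        by (rule has_derivative_imp_has_field_derivative) simp
    qed
    have "(G has_derivative H) (at (?l 0))" using G(2) by simp
    from has_derivative_inner_left[OF has_derivative_compose[OF dl this], of ?e]
    have d2: "(?d has_real_derivative H ?e $ i) (at 0)"
      by (rule has_derivative_imp_has_field_derivative) (simp add: inner_axis linear_scale[OF has_derivative_linear[OF G(2)]])
    have fmin: "f x \<le> f (?l t)" if "\<bar>t\<bar> < r" for t
      using inb[OF that] r(2) min by blast
    have "?d 0 = 0"
    proof (rule DERIV_local_min[OF d1 r(1)])
      show "\<forall>y. \<bar>0 - y\<bar> < r \<longrightarrow> f (?l 0) \<le> f (?l y)"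
        using fmin by auto
    qed (use r in auto)
    moreover obtain s where s: "s > 0" "\<And>h. 0 < h \<Longrightarrow> h < s \<Longrightarrow> ?d (0 + h) < ?d 0"
      using DERIV_neg_dec_right[OF d2] neg by auto
    ultimately have sneg: "?d h < 0" if "0 < h" "h < s" for h using that by fastforce
    define t where "t = min s r / 2"
    have t: "0 < t" "t < s" "t < r" using s(1) r(1) by (auto simp: t_def)
    have "\<exists>z. 0 < z \<and> z < t \<and> f (?l t) - f (?l 0) = (t - 0) * ?d z"
      using t by (intro MVT2) (auto intro!: d1)
    then obtain z where "0 < z" "z < t" "f (?l t) - f (?l 0) = t * ?d z" by auto
    then have "f (?l t) < f x" using sneg[of z] t mult_pos_neg[of t "?d z"] by auto
    moreover have "f x \<le> f (?l t)" using fmin[of t] t by auto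
    ultimately show False by simp
  qed
  then show ?thesis unfolding G(3) trace_matrix by (simp add: sum_nonneg)
qed

text \<open>The zero function \<open>f - f\<close> has a minimum everywhere, so its Laplacian has a sign.\<close>

lemma has_lap_unique:
  assumes "has_lap f x L" "has_lap f x M"
  shows "L = M"
proof -
  have "L \<ge> M" if "has_lap f x L" "has_lap f x M" for L M
    using has_lap_local_min[OF has_lap_diff[OF that], of UNIV] by simp
  from this[OF assms] this[OF assms(2,1)] show ?thesis by simp
qed

section \<open>Laplacians of plane waves and of radial functions\<close>

lemma has_lap_plane_wave:
  fixes e :: "real ^ 'n::finite"
  assumes "\<And>t. (\<phi> has_real_derivative \<phi>' t) (at t)"
    and "(\<phi>' has_real_derivative \<phi>'') (at (x \<bullet> e))"
  shows "has_lap (\<lambda>y. \<phi> (y \<bullet> e)) x (\<phi>'' * (e \<bullet> e))"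
proof (rule has_lapI[of UNIV])
  have di: "((\<lambda>y. y \<bullet> e) has_derivative (\<lambda>h. h \<bullet> e)) (at y)" for y
    by (auto intro!: derivative_eq_intros)
  show "((\<lambda>y. \<phi> (y \<bullet> e)) has_derivative (\<lambda>h. (\<phi>' (y \<bullet> e) *\<^sub>R e) \<bullet> h)) (at y)" for y
    using has_derivative_compose[OF di assms(1)[unfolded has_field_derivative_def], of y]
    by (simp add: inner_commute[of e])
  show "((\<lambda>y. \<phi>' (y \<bullet> e) *\<^sub>R e) has_derivative (\<lambda>h. \<phi>'' *\<^sub>R ((e \<bullet> h) *\<^sub>R e))) (at x)"
    using has_derivative_scaleR_left[OF has_derivative_compose[OF di assms(2)[unfolded has_field_derivative_def]]]
    by (simp add: inner_commute[of e])
  show "\<phi>'' * (e \<bullet> e) = trace (matrix (\<lambda>h. \<phi>'' *\<^sub>R ((e \<bullet> h) *\<^sub>R e)))"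
    by (simp only: trace_matrix_scale trace_matrix_rank1)
qed auto

text \<open>Radial functions are written through the squared distance because it is smooth even at
  \<open>a\<close>. The Hessian is a rank-one term with factor 4 \<open>\<phi>''\<close> plus 2
  \<open>\<phi>'\<close> times the identity.\<close>

lemma has_lap_sqdist:
  fixes a :: "real ^ 'n::finite"
  assumes S: "open S" "x \<in> S"
    and d1: "\<And>y. y \<in> S \<Longrightarrow> (\<phi> has_real_derivative \<phi>' ((y - a) \<bullet> (y - a))) (at ((y - a) \<bullet> (y - a)))"
    and d2: "(\<phi>' has_real_derivative \<phi>'') (at ((x - a) \<bullet> (x - a)))"
  shows "has_lap (\<lambda>y. \<phi> ((y - a) \<bullet> (y - a))) x
           (4 * ((x - a) \<bullet> (x - a)) * \<phi>'' + 2 * real CARD('n) * \<phi>' ((x - a) \<bullet> (x - a)))"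
proof (rule has_lapI[OF S])
  let ?s = "\<lambda>y. (y - a) \<bullet> (y - a)"
  have di: "(?s has_derivative (\<lambda>h. 2 * ((y - a) \<bullet> h))) (at y)" for y
    by (auto intro!: derivative_eq_intros simp: inner_commute)
  show "((\<lambda>y. \<phi> (?s y)) has_derivative (\<lambda>h. ((2 * \<phi>' (?s y)) *\<^sub>R (y - a)) \<bullet> h)) (at y)" if "y \<in> S" for y
    using has_derivative_compose[OF di d1[OF that, unfolded has_field_derivative_def]]
    by (simp add: mult_ac)
  let ?H = "\<lambda>h. (4 * \<phi>'') *\<^sub>R (((x - a) \<bullet> h) *\<^sub>R (x - a)) + (2 * \<phi>' (?s x)) *\<^sub>R h"
  have "((\<lambda>y. 2 * \<phi>' (?s y)) has_derivative (\<lambda>h. 4 * \<phi>'' * ((x - a) \<bullet> h))) (at x)"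
    using has_derivative_mult_right[OF has_derivative_compose[OF di d2[unfolded has_field_derivative_def]], of 2]
    by (simp add: mult_ac)
  then have "((\<lambda>y. (2 * \<phi>' (?s y)) *\<^sub>R (y - a)) has_derivative
      (\<lambda>h. (2 * \<phi>' (?s x)) *\<^sub>R h + (4 * \<phi>'' * ((x - a) \<bullet> h)) *\<^sub>R (x - a))) (at x)"
    by (rule has_derivative_scaleR) (auto intro!: derivative_eq_intros)
  then show "((\<lambda>y. (2 * \<phi>' (?s y)) *\<^sub>R (y - a)) has_derivative ?H) (at x)"
    by (simp add: add.commute)
  show "4 * ?s x * \<phi>'' + 2 * real CARD('n) * \<phi>' (?s x) = trace (matrix ?H)"
    by (simp only: trace_matrix_add trace_matrix_scale trace_matrix_rank1 trace_matrix_ident)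
       (simp add: algebra_simps)
qed

section \<open>The strong minimum principle\<close>

lemma DERIV_inverse_power:
  fixes t :: real
  assumes "t \<noteq> 0"
  shows "((\<lambda>t. inverse t ^ n) has_real_derivative - real n * inverse t ^ (n + 1)) (at t)"
proof (cases n)
  case (Suc m)
  have "(inverse has_real_derivative - (inverse t ^ 2)) (at t)"
    using DERIV_inverse[OF assms] by (simp add: numeral_2_eq_2)
  from DERIV_power[OF this, of n] show ?thesis
    by (simp add: Suc power2_eq_square algebra_simps)
qed simp

text \<open>Comparison on an annulus with the strictly subharmonic barrier
  \<open>|z - y|\<close> to the power \<open>-2N\<close>, shifted to vanish on the sphere of radius \<open>r\<close>.\<close>

lemma superharmonic_pos_on_ball:
  fixes w :: "real ^ 'n::finite \<Rightarrow> real"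
  assumes cont: "continuous_on (cball y r) w"
    and nonneg: "\<And>x. x \<in> cball y r \<Longrightarrow> 0 \<le> w x"
    and lap: "\<And>x. x \<in> ball y r \<Longrightarrow> \<exists>L\<le>0. has_lap w x L"
    and pos: "0 < w y" and x: "x \<in> ball y r"
  shows "0 < w x"
proof (cases "x = y")
  case False
  define N where "N = CARD('n)"
  have N: "N > 0" by (simp add: N_def)
  define s where "s = (\<lambda>z. (z - y) \<bullet> (z - y))"
  have s_dist: "s z = (dist y z)\<^sup>2" for z
    by (simp add: s_def dist_norm norm_minus_commute[of y] power2_norm_eq_inner)
  define \<phi> where "\<phi> = (\<lambda>t::real. inverse t ^ N - inverse (r\<^sup>2) ^ N)"
  define \<phi>' where "\<phi>' = (\<lambda>t::real. - real N * inverse t ^ (N + 1))"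
  define \<phi>'' where "\<phi>'' = (\<lambda>t::real. real N * real (N + 1) * inverse t ^ (N + 2))"
  have d1: "(\<phi> has_real_derivative \<phi>' t) (at t)" if "t > 0" for t
    unfolding \<phi>_def \<phi>'_def
    using DERIV_diff[OF DERIV_inverse_power DERIV_const] that by fastforce
  have d2: "(\<phi>' has_real_derivative \<phi>'' t) (at t)" if "t > 0" for t
    using DERIV_cmult[OF DERIV_inverse_power[of t "N + 1"], of "- real N"] that
    by (simp add: \<phi>'_def \<phi>''_def algebra_simps)
  have lap_\<phi>: "\<exists>L>0. has_lap (\<lambda>z. \<phi> (s z)) z L" if "z \<noteq> y" for z
  proof -
    have sz: "s z > 0" using that by (simp add: s_def)
    have "has_lap (\<lambda>z. \<phi> (s z)) z (4 * s z * \<phi>'' (s z) + 2 * real CARD('n) * \<phi>' (s z))"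
      unfolding s_def
      by (rule has_lap_sqdist[of "- {y}"])
         (use that in \<open>auto intro!: d1 d2\<close>)
    \<comment> \<open>The coefficient is 4N(N+1) - 2N^2. For a general power t^(-a) it would be
      2a(2a + 2 - N), so the exponent N is a convenient choice with a positive value in every
      dimension.\<close>
    moreover have "4 * s z * \<phi>'' (s z) + 2 * real CARD('n) * \<phi>' (s z)
        = (4 * real N + 2 * real N * real N) * inverse (s z) ^ (N + 1)"
      using sz by (simp add: \<phi>'_def \<phi>''_def N_def[symmetric] field_simps)
    moreover have "\<dots> > 0" using sz N by (intro mult_pos_pos) (auto intro: add_pos_nonneg)
    ultimately show ?thesis by auto
  qed
  have r: "r > 0" using x by (metis ball_empty empty_iff not_le)
  have "isCont w y"
    using cont r by (intro continuous_on_interior[OF cont]) (simp add: interior_cball)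
  then obtain d where d: "d > 0" "\<And>z. dist z y < d \<Longrightarrow> dist (w z) (w y) < w y / 2"
    unfolding continuous_at_eps_delta[of y w] using pos by (meson half_gt_zero)
  \<comment> \<open>Small enough that \<open>w\<close> stays above \<open>w y / 2\<close> on the
    inner sphere and that \<open>x\<close> lies in the annulus.\<close>
  define \<delta> where "\<delta> = min d (dist y x) / 2"
  have \<delta>: "\<delta> > 0" "\<delta> < d" "\<delta> < dist y x"
    using d(1) False by (auto simp: \<delta>_def min_def)
  have near: "w y / 2 \<le> w z" if "dist y z = \<delta>" for z
  proof -
    have "\<bar>w z - w y\<bar> < w y / 2"
      using d(2)[of z] that \<delta>(2) by (simp only: dist_commute[of z y] dist_real_def)
    then show ?thesis by linarith
  qed
  \<comment> \<open>Makes \<open>\<eta>\<close> times the unshifted barrier equal to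
    \<open>w y / 2\<close> on the inner sphere.\<close>
  define \<eta> where "\<eta> = w y / 2 * (\<delta>\<^sup>2) ^ N"
  have \<eta>: "\<eta> > 0" using pos \<delta> by (simp add: \<eta>_def)
  define A where "A = cball y r - ball y \<delta>"
  define F where "F = (\<lambda>z. w z - \<eta> * \<phi> (s z))"
  have "compact A" unfolding A_def by (simp add: compact_diff)
  moreover have xA: "x \<in> A" using x \<delta> by (auto simp: A_def)
  moreover have "continuous_on A F"
    unfolding F_def \<phi>_def s_def
    by (intro continuous_intros continuous_on_subset[OF cont])
       (use \<delta> in \<open>auto simp: A_def\<close>)
  ultimately obtain z where z: "z \<in> A" "\<And>a. a \<in> A \<Longrightarrow> F z \<le> F a"
    using continuous_attains_inf[of A F] by blast
  \<comment> \<open>A negative minimum cannot lie on either sphere, and in the open annulus the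
    Laplacian of \<open>F\<close> is strictly negative.\<close>
  have "F z \<ge> 0"
  proof (rule ccontr)
    assume neg: "\<not> F z \<ge> 0"
    have "dist y z \<noteq> r"
      using neg nonneg[of z] by (auto simp: F_def \<phi>_def s_dist)
    moreover have "dist y z \<noteq> \<delta>"
    proof
      assume eq: "dist y z = \<delta>"
      have "\<eta> * \<phi> (s z) \<le> \<eta> * inverse (\<delta>\<^sup>2) ^ N"
        using \<eta> by (intro mult_left_mono) (auto simp: \<phi>_def s_dist eq)
      also have "\<dots> = w y / 2"
        using \<delta> by (simp add: \<eta>_def power_inverse)
      finally show False using near[OF eq] neg by (simp add: F_def)
    qed
    ultimately have zin: "z \<in> ball y r - cball y \<delta>" using z(1) by (auto simp: A_def)
    then have "z \<noteq> y" using \<delta> by auto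
    then obtain L' where L': "L' > 0" "has_lap (\<lambda>z. \<phi> (s z)) z L'" using lap_\<phi> by blast
    obtain L where L: "L \<le> 0" "has_lap w z L" using lap zin by blast
    have "has_lap F z (L - \<eta> * L')"
      unfolding F_def by (intro has_lap_diff has_lap_cmult L L')
    then have "L - \<eta> * L' \<ge> 0"
      by (rule has_lap_local_min[where S = "ball y r - cball y \<delta>"])
         (use zin z(2) in \<open>auto simp: A_def open_Diff\<close>)
    moreover have "\<eta> * L' > 0" using \<eta> L' by simp
    ultimately show False using L(1) by linarith
  qed
  then have "F x \<ge> 0" using z(2)[OF xA] by simp
  moreover have "\<phi> (s x) > 0"
  proof -
    have "dist y x < r" using x by simp
    then have "s x < r\<^sup>2" unfolding s_dist by (intro power_strict_mono) auto
    moreover have "s x > 0" using False by (simp add: s_def)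
    ultimately have "inverse (r\<^sup>2) < inverse (s x)" by (simp add: less_imp_inverse_less)
    then have "inverse (r\<^sup>2) ^ N < inverse (s x) ^ N"
      using N by (intro power_strict_mono) auto
    then show ?thesis by (simp add: \<phi>_def)
  qed
  then have "\<eta> * \<phi> (s x) > 0" using \<eta> by simp
  ultimately show ?thesis by (simp add: F_def)
qed (use pos in simp)

text \<open>Positivity spreads from a point to a whole ball around it. Hence a zero has no positive
  points close by, since the ball around such a point would reach back to the zero. So zeros and
  positive points both form open sets, and connectedness decides.\<close>

lemma strong_minimum_principle:
  fixes w :: "real ^ 'n::finite \<Rightarrow> real"
  assumes S: "open S" "connected S" and cont: "continuous_on S w"
    and nonneg: "\<And>x. x \<in> S \<Longrightarrow> 0 \<le> w x"
    and lap: "\<And>x. x \<in> S \<Longrightarrow> \<exists>L\<le>0. has_lap w x L"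
    and z: "z \<in> S" "w z = 0" and x: "x \<in> S"
  shows "w x = 0"
proof (rule ccontr)
  assume "w x \<noteq> 0"
  define P where "P = {x \<in> S. 0 < w x}"
  define Z where "Z = {x \<in> S. w x = 0}"
  have spread: "0 < w a" if "ball b (2 * r) \<subseteq> S" "c \<in> ball b r" "0 < w c" "a \<in> ball b r"
    "dist c a < r" for a b c r
  proof -
    have "cball c r \<subseteq> ball b (2 * r)"
    proof
      fix q assume "q \<in> cball c r"
      then show "q \<in> ball b (2 * r)"
        using that(2) dist_triangle[of b q c] by auto
    qed
    then have sub: "cball c r \<subseteq> S" using that(1) by blast
    show ?thesis
    proof (rule superharmonic_pos_on_ball[of c r w a])
      show "continuous_on (cball c r) w" by (rule continuous_on_subset[OF cont sub])
      show "0 \<le> w q" if "q \<in> cball c r" for q using nonneg sub that by blast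
      show "\<exists>L\<le>0. has_lap w q L" if "q \<in> ball c r" for q
        by (rule lap) (use sub that in \<open>auto simp: subset_iff\<close>)
    qed (use that in auto)
  qed
  have "P = S \<inter> w -` {0<..}" by (auto simp: P_def)
  then have "open P" using continuous_open_preimage[OF cont S(1), of "{0<..}"] by simp
  moreover have "open Z"
    unfolding open_contains_ball
  proof
    fix b assume b: "b \<in> Z"
    obtain r where r: "r > 0" "ball b r \<subseteq> S"
      using b S(1) by (auto simp: Z_def open_contains_ball)
    have "ball b (r / 2) \<subseteq> Z"
    proof
      fix q assume q: "q \<in> ball b (r / 2)"
      then have qS: "q \<in> S" using r by auto
      have "\<not> 0 < w q"
      proof
        assume "0 < w q"
        then have "0 < w b"
          using spread[of b "r / 2" q b] q r by (auto simp: dist_commute)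
        then show False using b by (simp add: Z_def)
      qed
      then show "q \<in> Z" using nonneg[OF qS] qS by (simp add: Z_def)
    qed
    then show "\<exists>e>0. ball b e \<subseteq> Z" using r by (intro exI[of _ "r / 2"]) auto
  qed
  moreover have "P \<inter> Z \<inter> S = {}" "S \<subseteq> P \<union> Z"
    using nonneg by (auto simp: P_def Z_def order_le_less)
  moreover have "P \<inter> S \<noteq> {}" using x \<open>w x \<noteq> 0\<close> nonneg[OF x] by (auto simp: P_def)
  moreover have "Z \<inter> S \<noteq> {}" using z by (auto simp: Z_def)
  ultimately show False using S(2) unfolding connected_def by blast
qed

section \<open>Moving planes\<close>

text \<open>The mean value theorem needs derivatives only inside the interval, so
  \<open>a = 0\<close> is covered. This is the Lipschitz constant of the nonlinearity in the moving
  plane step, the energy estimate and the clipped equation.\<close>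

lemma powr_diff_le:
  fixes a b p M :: real
  assumes "1 < p" "0 \<le> a" "a \<le> b" "b \<le> M"
  shows "b powr p - a powr p \<le> p * M powr (p - 1) * (b - a)"
proof (cases "a < b")
  case True
  have c: "continuous_on {a..b} (\<lambda>t. t powr p)"
    using assms by (intro continuous_on_powr') (auto intro!: continuous_intros)
  have d: "((\<lambda>t. t powr p) has_real_derivative p * t powr (p - 1)) (at t)"
    if "a < t" "t < b" for t
    using that assms by (auto intro!: derivative_eq_intros)
  obtain l t where t: "a < t" "t < b" "DERIV (\<lambda>t. t powr p) t :> l" "b powr p - a powr p = (b - a) * l"
    using MVT[OF True c] d real_differentiable_def by blast
  then have l: "l = p * t powr (p - 1)" using d DERIV_unique by blast
  have "t powr (p - 1) \<le> M powr (p - 1)"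
    using t assms by (intro powr_mono2) auto
  then have "(b - a) * (p * t powr (p - 1)) \<le> (b - a) * (p * M powr (p - 1))"
    using assms by (intro mult_left_mono) auto
  with t(4) show ?thesis unfolding l by (simp add: mult_ac)
qed (use assms in auto)

text \<open>For \<open>0 \<le> c\<close> and \<open>c \<le> x \<bullet> e\<close> the correction is
  nonpositive: reflection brings points of the cap closer to the origin, so it stays in the
  ball.\<close>

lemma inner_reflect_self:
  assumes "norm e = 1"
  shows "reflect e c x \<bullet> reflect e c x = x \<bullet> x - 4 * c * (x \<bullet> e - c)"
proof -
  have "e \<bullet> e = 1" using assms by (simp add: norm_eq_1)
  then show ?thesis by (simp add: reflect_def algebra_simps inner_commute)
qed

lemma dist_reflect:
  assumes "norm e = 1"
  shows "dist (reflect e c x) (reflect e d x) = 2 * \<bar>c - d\<bar>"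
proof -
  have "reflect e c x - reflect e d x = (2 * (c - d)) *\<^sub>R e"
    by (simp add: reflect_def algebra_simps)
  then have "dist (reflect e c x) (reflect e d x) = \<bar>2 * (c - d)\<bar>"
    using assms by (simp only: dist_norm norm_scaleR mult_1_right)
  then show ?thesis by (simp only: abs_mult abs_numeral)
qed

lemma continuous_on_reflect [continuous_intros]:
  "continuous_on S f \<Longrightarrow> continuous_on S (\<lambda>x. reflect e c (f x))"
  unfolding reflect_def by (intro continuous_intros)

lemma mem_ball_iff_inner:
  fixes x :: "'a::real_inner"
  shows "x \<in> ball 0 1 \<longleftrightarrow> x \<bullet> x < 1" "x \<in> cball 0 1 \<longleftrightarrow> x \<bullet> x \<le> 1" "x \<in> sphere 0 1 \<longleftrightarrow> x \<bullet> x = 1"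
  by (simp_all add: norm_eq_sqrt_inner)

locale emden =
  fixes p :: real and u :: "real ^ 'n::finite \<Rightarrow> real"
  assumes p: "1 < p" and sol: "emden_solution p u"
begin

lemma cont: "continuous_on (cball 0 1) u"
  and pos: "x \<in> ball 0 1 \<Longrightarrow> 0 < u x"
  and bdry: "x \<in> sphere 0 1 \<Longrightarrow> u x = 0"
  using sol by (auto simp: emden_solution_def)

lemma nonneg: "x \<in> cball 0 1 \<Longrightarrow> 0 \<le> u x"
  using pos[of x] bdry[of x] by (auto simp: order_le_less)

lemma lap: "x \<in> ball 0 1 \<Longrightarrow> has_lap u x (- (u x powr p))"
  using C2_on_has_lap[of "ball 0 1" u x] sol
  unfolding emden_solution_def by (metis minus_minus open_ball)

end

section \<open>Domination by the reflection in a fixed direction\<close>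

locale moving_plane = emden p u for p and u :: "real ^ 'n::finite \<Rightarrow> real" +
  fixes e :: "real ^ 'n::finite"
  assumes e: "norm e = 1"
begin

definition dominates :: "real \<Rightarrow> bool" where
  "dominates c \<longleftrightarrow> (\<forall>x\<in>cball 0 1. c \<le> x \<bullet> e \<longrightarrow> u x \<le> u (reflect e c x))"

lemma reflect_mem:
  assumes "0 \<le> c" "c \<le> x \<bullet> e"
  shows "x \<in> cball 0 1 \<Longrightarrow> reflect e c x \<in> cball 0 1"
    and "x \<in> ball 0 1 \<Longrightarrow> reflect e c x \<in> ball 0 1"
proof -
  have "0 \<le> c * (x \<bullet> e - c)" using assms by simp
  then show "x \<in> cball 0 1 \<Longrightarrow> reflect e c x \<in> cball 0 1"
    and "x \<in> ball 0 1 \<Longrightarrow> reflect e c x \<in> ball 0 1"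
    unfolding mem_ball_iff_inner inner_reflect_self[OF e] by simp_all
qed

lemma continuous_on_diff_reflect:
  assumes "0 \<le> c"
  shows "continuous_on {x \<in> cball 0 1. c \<le> x \<bullet> e} (\<lambda>x. u (reflect e c x) - u x)"
  by (intro continuous_intros continuous_on_compose2[OF cont] continuous_on_subset[OF cont])
     (use assms reflect_mem in auto)

lemma lap_diff_reflect:
  assumes "0 \<le> c" "x \<in> ball 0 1" "c \<le> x \<bullet> e"
  shows "has_lap (\<lambda>x. u (reflect e c x) - u x) x (u x powr p - u (reflect e c x) powr p)"
  using has_lap_diff[OF has_lap_reflect[OF e lap] lap] reflect_mem(2)[OF assms(1,3)] assms(2)
  by simp

text \<open>Domination makes the difference \<open>w\<close> nonnegative and superharmonic on the
  cap. If it vanished once, it would vanish on the whole cap and, by continuity, at the pole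
  \<open>e\<close>; but there \<open>u\<close> is 0 while the mirror image of \<open>e\<close> lies
  in the open ball.\<close>

lemma dominates_strict:
  assumes c: "0 < c" and dom: "dominates c" and x: "x \<in> ball 0 1" "c < x \<bullet> e"
  shows "u x < u (reflect e c x)"
proof (rule ccontr)
  assume "\<not> u x < u (reflect e c x)"
  define S where "S = {x \<in> ball 0 1. c < x \<bullet> e}"
  define w where "w = (\<lambda>x. u (reflect e c x) - u x)"
  have SI: "S = ball 0 1 \<inter> {x. x \<bullet> e > c}" by (auto simp: S_def)
  have w0: "0 \<le> w y" if "y \<in> cball 0 1" "c \<le> y \<bullet> e" for y
    using dom that by (simp add: dominates_def w_def)
  have "w x = 0"
    using w0[of x] x \<open>\<not> u x < u (reflect e c x)\<close> by (simp add: w_def)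
  have "open S" unfolding SI
    using open_halfspace_gt[of c e] by (auto simp: inner_commute)
  moreover have "connected S" unfolding SI
    using convex_halfspace_gt[of c e]
    by (auto simp: inner_commute intro!: convex_connected convex_Int)
  moreover have "continuous_on S w" unfolding w_def
    by (rule continuous_on_subset[OF continuous_on_diff_reflect]) (use c in \<open>auto simp: S_def\<close>)
  moreover have "\<exists>L\<le>0. has_lap w y L" if "y \<in> S" for y
  proof (intro exI conjI)
    show "has_lap w y (u y powr p - u (reflect e c y) powr p)"
      unfolding w_def by (rule lap_diff_reflect) (use that c in \<open>auto simp: S_def\<close>)
    have "u y powr p \<le> u (reflect e c y) powr p"
      using w0[of y] that p pos[of y] by (intro powr_mono2) (auto simp: S_def w_def)
    then show "u y powr p - u (reflect e c y) powr p \<le> 0" by simp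
  qed
  ultimately have wS: "w y = 0" if "y \<in> S" for y
    using strong_minimum_principle[of S w x y] w0 x \<open>w x = 0\<close> that by (auto simp: S_def)
  have c1: "c < 1"
    using x Cauchy_Schwarz_ineq2[of x e] e by auto
  have ee: "e \<bullet> e = 1" using e by (simp add: norm_eq_1)
  \<comment> \<open>Points on the axis of the cap tending to the pole. With \<open>n + 1\<close> in
    place of \<open>n + 2\<close> the first one would lie on the plane itself.\<close>
  define X where "X = (\<lambda>n. (1 - (1 - c) / real (n + 2)) *\<^sub>R e)"
  have "X n \<in> S" for n
  proof -
    have "0 < (1 - c) / real (n + 2)" "(1 - c) / real (n + 2) < 1 - c"
      using c1 mult_strict_right_mono[OF c1, of "1 + real n"] by (auto simp: field_simps)
    then show ?thesis using e ee c by (auto simp: X_def S_def)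
  qed
  moreover have "X \<longlonglongrightarrow> (1 - 0) *\<^sub>R e"
    unfolding X_def
    by (intro tendsto_intros LIMSEQ_ignore_initial_segment[OF lim_const_over_n])
  then have "X \<longlonglongrightarrow> e" by simp
  moreover have "continuous_on {x \<in> cball 0 1. c \<le> x \<bullet> e} w"
    unfolding w_def using continuous_on_diff_reflect c by simp
  ultimately have "(\<lambda>n. w (X n)) \<longlonglongrightarrow> w e"
    by (rule_tac continuous_on_tendsto_compose[where s = "{x \<in> cball 0 1. c \<le> x \<bullet> e}"])
       (use c1 e ee in \<open>auto simp: S_def intro!: always_eventually intro: less_imp_le\<close>)
  moreover have "(\<lambda>n. w (X n)) = (\<lambda>n. 0)" using wS \<open>\<And>n. X n \<in> S\<close> by auto
  ultimately have "w e = 0" using LIMSEQ_unique[OF _ tendsto_const[of 0]] by simp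
  moreover have "reflect e c e \<in> ball 0 1"
    using c c1 ee unfolding mem_ball_iff_inner inner_reflect_self[OF e] by simp
  then have "u (reflect e c e) > 0" by (rule pos)
  moreover have "u e = 0" using e by (intro bdry) simp
  ultimately show False by (simp add: w_def)
qed

text \<open>Away from a compact \<open>K\<close> the cap consists of two narrow layers, along the plane and along
  the sphere. There the barrier \<open>g\<close> satisfies \<open>\<Delta>g + C g < 0\<close>, where \<open>C\<close> is a Lipschitz constant of
  the nonlinearity, which excludes a negative minimum of \<open>w / g\<close>. Unlike the usual argument this
  needs no maximum principle for domains of small measure. For \<open>c = 1\<close> the set \<open>K\<close> is empty, so the
  start of the procedure is not a separate case.\<close>

lemma dominates_step:
  assumes c: "0 < c" "c \<le> 1" and dom: "dominates c"
  shows "\<exists>\<epsilon>>0. \<forall>\<mu>. c - \<epsilon> < \<mu> \<longrightarrow> \<mu> \<le> c \<longrightarrow> 0 \<le> \<mu> \<longrightarrow> dominates \<mu>"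
proof -
  have "\<exists>z\<in>cball 0 1. \<forall>y\<in>cball 0 1. u y \<le> u z"
    by (rule continuous_attains_sup[OF _ _ cont]) auto
  then obtain z where "\<And>y. y \<in> cball 0 1 \<Longrightarrow> u y \<le> u z" by blast
  then obtain M where M: "\<And>y. y \<in> cball 0 1 \<Longrightarrow> u y \<le> M" by blast
  define C where "C = p * M powr (p - 1)"
  have C: "C \<ge> 0" using p by (simp add: C_def)
  \<comment> \<open>Two demands: k^2/3, the lower bound for minus the Laplacian of \<open>g\<close>,
    must exceed 4C, an upper bound for C \<open>g\<close>; and \<open>k \<ge> 2\<close> forces |x|^2
    > 1/2 in the layer along the sphere.\<close>
  define k where "k = 2 + 12 * C"
  have k: "k \<ge> 2" "4 * C < k\<^sup>2 / 3"
  proof -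
    show k2: "k \<ge> 2" using C by (simp add: k_def)
    have "2 * k \<le> k\<^sup>2" using k2 by (simp add: power2_eq_square)
    moreover have "12 * C = k - 2" by (simp add: k_def)
    ultimately show "4 * C < k\<^sup>2 / 3" using k2 by linarith
  qed
  \<comment> \<open>The margin is half the layer width 1/k: the plane may still descend by 1/(2k),
    and points outside \<open>K\<close> remain within 1/k of the new plane or in the layer at the
    sphere.\<close>
  define K where "K = {x \<in> cball 0 1. c + 1 / (2 * k) \<le> x \<bullet> e \<and> x \<bullet> x \<le> 1 - 1 / k}"
  have Kball: "x \<in> ball 0 1" "c < x \<bullet> e" if "x \<in> K" for x
  proof -
    have "1 / k > 0" "1 / (2 * k) > 0" using k(1) by auto
    then show "x \<in> ball 0 1" "c < x \<bullet> e"
      using that unfolding mem_ball_iff_inner K_def mem_Collect_eq by linarith+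
  qed
  have "closed {x. c + 1 / (2 * k) \<le> x \<bullet> e \<and> x \<bullet> x \<le> 1 - 1 / k}"
    by (intro closed_Collect_conj closed_Collect_le continuous_intros)
  moreover have "K = cball 0 1 \<inter> {x. c + 1 / (2 * k) \<le> x \<bullet> e \<and> x \<bullet> x \<le> 1 - 1 / k}"
    by (auto simp: K_def)
  ultimately have cK: "compact K" by (simp only: compact_Int_closed[OF compact_cball])
  have "\<exists>\<delta>>0. \<forall>x\<in>K. \<delta> \<le> u (reflect e c x) - u x"
  proof (cases "K = {}")
    case False
    have "continuous_on K (\<lambda>x. u (reflect e c x) - u x)"
      by (rule continuous_on_subset[OF continuous_on_diff_reflect[of c]])
         (use c Kball in \<open>auto simp: K_def intro: less_imp_le\<close>)
    then obtain x where x: "x \<in> K" "\<forall>y\<in>K. u (reflect e c x) - u x \<le> u (reflect e c y) - u y"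
      using continuous_attains_inf[OF cK False] by blast
    moreover have "0 < u (reflect e c x) - u x"
      using dominates_strict[OF c(1) dom Kball[OF x(1)]] by simp
    ultimately show ?thesis by blast
  qed (auto intro: exI[of _ 1])
  then obtain \<delta> where \<delta>: "\<delta> > 0" "\<And>x. x \<in> K \<Longrightarrow> \<delta> \<le> u (reflect e c x) - u x" by blast
  have "uniformly_continuous_on (cball 0 1) u"
    by (rule compact_uniformly_continuous[OF cont]) simp
  then obtain \<eta> where \<eta>: "\<eta> > 0"
    "\<And>x y. x \<in> cball 0 1 \<Longrightarrow> y \<in> cball 0 1 \<Longrightarrow> dist y x < \<eta> \<Longrightarrow> dist (u y) (u x) < \<delta>"
    using \<delta>(1) unfolding uniformly_continuous_on_def by metis
  \<comment> \<open>The second bound is halved because moving the plane by h moves mirror images by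
    2h.\<close>
  define \<epsilon> where "\<epsilon> = min (1 / (2 * k)) (\<eta> / 2)"
  have "dominates \<mu>" if \<mu>: "c - \<epsilon> < \<mu>" "\<mu> \<le> c" "0 \<le> \<mu>" for \<mu>
  proof (rule ccontr)
    assume "\<not> dominates \<mu>"
    define D where "D = {x \<in> cball 0 1. \<mu> \<le> x \<bullet> e}"
    define w where "w = (\<lambda>x. u (reflect e \<mu> x) - u x)"
    \<comment> \<open>The first exponential supplies curvature along the sphere, the second along
      the plane. Each is at most 1 on the cap, so the constant 4 keeps \<open>g\<close> between 2
      and 4.\<close>
    define g where "g = (\<lambda>x. 4 - exp (k * (x \<bullet> x - 1)) - exp (- k * (x \<bullet> e - \<mu>)))"
    obtain a where a: "a \<in> D" "w a < 0"
      using \<open>\<not> dominates \<mu>\<close> by (auto simp: dominates_def D_def w_def not_le)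
    have g_bounds: "2 \<le> g x" "g x \<le> 4" if "x \<in> D" for x
    proof -
      have "x \<bullet> x \<le> 1" "\<mu> \<le> x \<bullet> e"
        using that unfolding D_def mem_ball_iff_inner[symmetric] by auto
      then have "k * (x \<bullet> x - 1) \<le> 0" "- k * (x \<bullet> e - \<mu>) \<le> 0"
        using k(1) by (auto simp: mult_le_0_iff)
      then have "exp (k * (x \<bullet> x - 1)) \<le> 1" "exp (- k * (x \<bullet> e - \<mu>)) \<le> 1"
        by (simp_all only: exp_le_one_iff)
      then show "2 \<le> g x" "g x \<le> 4"
        using exp_ge_zero[of "k * (x \<bullet> x - 1)"] exp_ge_zero[of "- k * (x \<bullet> e - \<mu>)"]
        unfolding g_def by linarith+
    qed
    have "closed {x. \<mu> \<le> x \<bullet> e}"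
      by (intro closed_Collect_le continuous_intros)
    moreover have "D = cball 0 1 \<inter> {x. \<mu> \<le> x \<bullet> e}" by (auto simp: D_def)
    ultimately have "compact D" by (simp only: compact_Int_closed[OF compact_cball])
    moreover have "continuous_on D (\<lambda>x. w x / g x)"
    proof (rule continuous_on_divide)
      show "continuous_on D w"
        unfolding D_def w_def by (rule continuous_on_diff_reflect[OF \<mu>(3)])
      show "continuous_on D g" unfolding g_def by (intro continuous_intros)
      show "\<forall>x\<in>D. g x \<noteq> 0" using g_bounds by fastforce
    qed
    ultimately obtain x where x: "x \<in> D" "\<And>y. y \<in> D \<Longrightarrow> w x / g x \<le> w y / g y"
      using continuous_attains_inf[of D "\<lambda>x. w x / g x"] a(1) by blast
    \<comment> \<open>With this factor \<open>w + t g\<close> is nonnegative on the cap and touches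
      0 at \<open>x\<close>; the contradiction is read off from its Laplacian there.\<close>
    define t where "t = - (w x / g x)"
    have t: "t > 0"
    proof -
      have "w a / g a < 0" using a g_bounds(1)[OF a(1)] by (simp add: divide_neg_pos)
      then show ?thesis using x(2)[OF a(1)] by (simp add: t_def)
    qed
    have wx: "w x = - t * g x" using g_bounds(1)[OF x(1)] by (simp add: t_def)
    have wy: "w y + t * g y \<ge> 0" if "y \<in> D" for y
      using x(2)[OF that] g_bounds(1)[OF that] by (simp add: t_def field_simps)
    have "w x < 0" using wx t g_bounds(1)[OF x(1)] by (simp add: mult_pos_pos)
    have xD: "x \<in> cball 0 1" "\<mu> \<le> x \<bullet> e" using x(1) by (auto simp: D_def)
    have Rx: "reflect e \<mu> x \<in> cball 0 1" using reflect_mem(1)[OF \<mu>(3) xD(2,1)] .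
    have "x \<notin> sphere 0 1"
    proof
      assume "x \<in> sphere 0 1"
      then show False using nonneg[OF Rx] bdry \<open>w x < 0\<close> by (simp add: w_def)
    qed
    then have xb: "x \<in> ball 0 1" using xD(1) by auto
    have "\<mu> \<noteq> x \<bullet> e" using \<open>w x < 0\<close> by (auto simp: w_def reflect_def)
    then have xe: "\<mu> < x \<bullet> e" using xD(2) by simp
    \<comment> \<open>On \<open>K\<close> the old plane left a gap of at least
      \<open>\<delta>\<close>, and the displacement of the mirror image costs less than
      that.\<close>
    have "x \<notin> K"
    proof
      assume xK: "x \<in> K"
      have "\<bar>\<mu> - c\<bar> < \<eta> / 2" using \<mu>(1,2) unfolding \<epsilon>_def by linarith
      then have "dist (reflect e \<mu> x) (reflect e c x) < \<eta>"
        by (simp add: dist_reflect[OF e])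
      moreover have "reflect e c x \<in> cball 0 1"
        using reflect_mem(1)[of c x] c xD(1) Kball(2)[OF xK] by simp
      ultimately have "\<bar>u (reflect e \<mu> x) - u (reflect e c x)\<bar> < \<delta>"
        using \<eta>(2)[OF _ Rx] by (simp add: dist_real_def)
      then show False using \<delta>(2)[OF xK] \<open>w x < 0\<close> unfolding w_def by linarith
    qed
    then have narrow: "1 - 1 / k < x \<bullet> x \<or> x \<bullet> e - \<mu> < 1 / k"
      using xD(1) \<mu>(1) by (auto simp: K_def \<epsilon>_def not_le)
    \<comment> \<open>The differences with 0 match the form of \<open>has_lap_sqdist\<close> with
      centre 0.\<close>
    define L1 where "L1 = 4 * ((x - 0) \<bullet> (x - 0)) * (k * (k * exp (k * ((x - 0) \<bullet> (x - 0) - 1))))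
      + 2 * real CARD('n) * (k * exp (k * ((x - 0) \<bullet> (x - 0) - 1)))"
    define L2 where "L2 = (- k) * ((- k) * exp (- k * (x \<bullet> e - \<mu>))) * (e \<bullet> e)"
    have l1: "has_lap (\<lambda>x. exp (k * ((x - 0) \<bullet> (x - 0) - 1))) x L1"
      unfolding L1_def
      by (rule has_lap_sqdist[of UNIV x "\<lambda>s. exp (k * (s - 1))" "\<lambda>s. k * exp (k * (s - 1))"])
         (auto intro!: derivative_eq_intros)
    have l2: "has_lap (\<lambda>x. exp (- k * (x \<bullet> e - \<mu>))) x L2"
      unfolding L2_def
      by (rule has_lap_plane_wave[of "\<lambda>s. exp (- k * (s - \<mu>))" "\<lambda>s. - k * exp (- k * (s - \<mu>))"])
         (auto intro!: derivative_eq_intros)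
    have lg: "has_lap g x (0 - L1 - L2)"
      unfolding g_def using has_lap_diff[OF has_lap_diff[OF has_lap_const[of 4] l1] l2] by simp
    have e3: "exp (- 1) \<ge> (1/3 :: real)"
    proof -
      have "exp 1 \<le> (3::real)" by (rule exp_le)
      then show ?thesis by (simp add: exp_minus field_simps)
    qed
    have L_bound: "k\<^sup>2 / 3 \<le> L1 + L2"
    proof -
      have L1nn: "0 \<le> L1" unfolding L1_def using k(1) by (intro add_nonneg_nonneg mult_nonneg_nonneg) auto
      have L2eq: "L2 = k\<^sup>2 * exp (- k * (x \<bullet> e - \<mu>))"
        using e by (simp add: L2_def norm_eq_1 power2_eq_square)
      from narrow show ?thesis
      proof
        assume s: "1 - 1 / k < x \<bullet> x"
        have "1 / k \<le> 1 / 2" using k(1) by (simp add: field_simps)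
        then have s2: "1 / 2 \<le> x \<bullet> x" using s by linarith
        have "- 1 \<le> k * (x \<bullet> x - 1)" using s k(1) by (simp add: field_simps)
        then have "exp (- 1) \<le> exp (k * (x \<bullet> x - 1))" by simp
        with e3 have E: "1 / 3 \<le> exp (k * (x \<bullet> x - 1))" by linarith
        have "k\<^sup>2 / 3 \<le> (4 * (1 / 2)) * k\<^sup>2 * (1 / 3)" by simp
        also have "\<dots> \<le> (4 * (x \<bullet> x)) * k\<^sup>2 * exp (k * (x \<bullet> x - 1))"
          using s2 E by (intro mult_mono) auto
        also have "\<dots> \<le> L1" using k(1) by (simp add: L1_def power2_eq_square mult_ac)
        finally show ?thesis unfolding L2eq by (simp add: add_increasing2)
      next
        assume "x \<bullet> e - \<mu> < 1 / k"
        then have "- 1 \<le> - k * (x \<bullet> e - \<mu>)" using k(1) by (simp add: field_simps)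
        then have "exp (- 1) \<le> exp (- k * (x \<bullet> e - \<mu>))" by simp
        with e3 have E: "1 / 3 \<le> exp (- k * (x \<bullet> e - \<mu>))" by linarith
        have "k\<^sup>2 / 3 \<le> k\<^sup>2 * exp (- k * (x \<bullet> e - \<mu>))"
          using mult_left_mono[OF E, of "k\<^sup>2"] by simp
        then show ?thesis using L1nn unfolding L2eq by linarith
      qed
    qed
    have "has_lap (\<lambda>x. w x + t * g x) x
        (u x powr p - u (reflect e \<mu> x) powr p + t * (0 - L1 - L2))"
      unfolding w_def
      by (intro has_lap_add has_lap_cmult lg lap_diff_reflect[OF \<mu>(3) xb xD(2)])
    \<comment> \<open>The touching relation turns the Lipschitz bound into t C \<open>g x\<close>,
      at most 4 C t, whereas the barrier contributes at most - t k^2/3.\<close>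
    then have "0 \<le> u x powr p - u (reflect e \<mu> x) powr p + t * (0 - L1 - L2)"
    proof (rule has_lap_local_min)
      have "{y \<in> ball 0 1. \<mu> < y \<bullet> e} = ball 0 1 \<inter> {y. \<mu> < e \<bullet> y}"
        by (auto simp: inner_commute)
      then show "open {y \<in> ball 0 1. \<mu> < y \<bullet> e}"
        using open_halfspace_gt[of \<mu> e] by auto
      show "x \<in> {y \<in> ball 0 1. \<mu> < y \<bullet> e}" using xb xe by simp
      show "w x + t * g x \<le> w y + t * g y" if "y \<in> {y \<in> ball 0 1. \<mu> < y \<bullet> e}" for y
        using wy[of y] that by (auto simp: wx D_def)
    qed
    also have "u x powr p - u (reflect e \<mu> x) powr p \<le> C * (u x - u (reflect e \<mu> x))"
      unfolding C_def
      by (rule powr_diff_le[OF p]) (use nonneg[OF Rx] M[OF xD(1)] \<open>w x < 0\<close> in \<open>auto simp: w_def\<close>)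
    also have "C * (u x - u (reflect e \<mu> x)) = t * (C * g x)"
    proof -
      have "u x - u (reflect e \<mu> x) = t * g x" using wx unfolding w_def by linarith
      then show ?thesis by simp
    qed
    also have "t * (C * g x) \<le> t * (C * 4)"
      using t C g_bounds(2)[OF x(1)] by (intro mult_left_mono) auto
    also have "t * (C * 4) + t * (0 - L1 - L2) = t * (4 * C - (L1 + L2))"
      by (simp add: algebra_simps)
    also have "\<dots> < 0" using t k(2) L_bound by (intro mult_pos_neg) auto
    finally show False by simp
  qed
  moreover have "\<epsilon> > 0" using k(1) \<eta>(1) by (simp add: \<epsilon>_def)
  ultimately show ?thesis by blast
qed

text \<open>A point strictly above the plane is also above all slightly higher planes, so its
  inequality passes to the limit in the height. Points on the plane are their own mirror
  images.\<close>

lemma dominates_limit: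
  assumes c: "0 \<le> c" "c < 1" and dom: "\<And>\<mu>. c < \<mu> \<Longrightarrow> \<mu> \<le> 1 \<Longrightarrow> dominates \<mu>"
  shows "dominates c"
  unfolding dominates_def
proof (intro ballI impI)
  fix x assume x: "x \<in> cball 0 1" "c \<le> x \<bullet> e"
  show "u x \<le> u (reflect e c x)"
  proof (cases "x \<bullet> e = c")
    case False
    define d where "d = x \<bullet> e"
    have d: "c < d" "d \<le> 1"
      using x False Cauchy_Schwarz_ineq2[of x e] e by (auto simp: d_def)
    have R: "continuous_on {c..d} (\<lambda>\<mu>. u (reflect e \<mu> x))"
    proof (rule continuous_on_compose2[OF cont])
      show "continuous_on {c..d} (\<lambda>\<mu>. reflect e \<mu> x)"
        unfolding reflect_def by (intro continuous_intros)
      show "(\<lambda>\<mu>. reflect e \<mu> x) ` {c..d} \<subseteq> cball 0 1"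
        using reflect_mem(1)[OF _ _ x(1)] c by (auto simp: d_def)
    qed
    then have "((\<lambda>\<mu>. u (reflect e \<mu> x)) \<longlongrightarrow> u (reflect e c x)) (at c within {c..d})"
      using d(1) by (simp add: continuous_on)
    then have "((\<lambda>\<mu>. u (reflect e \<mu> x)) \<longlongrightarrow> u (reflect e c x)) (at_right c)"
      using d(1) by (simp add: at_within_Icc_at_right)
    moreover have "\<forall>\<^sub>F \<mu> in at_right c. u x \<le> u (reflect e \<mu> x)"
      unfolding eventually_at_right_field
      by (intro exI[of _ d]) (use d dom x in \<open>auto simp: dominates_def d_def\<close>)
    ultimately show ?thesis
      by (rule tendsto_lowerbound) simp
  qed (simp add: reflect_def)
qed

lemma dominates_one: "dominates 1"
  unfolding dominates_def
proof (intro ballI impI)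
  fix x assume x: "x \<in> cball 0 1" "1 \<le> x \<bullet> e"
  have "x \<bullet> e \<le> norm x * norm e" by (rule norm_cauchy_schwarz)
  then have "x \<bullet> e = 1" using x e by simp
  then show "u x \<le> u (reflect e 1 x)" by (simp add: reflect_def)
qed

text \<open>Let \<open>s\<close> be the supremum of the heights at which domination fails. It holds
  at \<open>s\<close> by the limit lemma; if \<open>s\<close> is positive, the step lemma extends it
  to an interval below \<open>s\<close>, where failures would have to accumulate.\<close>

lemma dominates_zero: "dominates 0"
proof (rule ccontr)
  assume "\<not> dominates 0"
  define B where "B = {c \<in> {0..1}. \<not> dominates c}"
  have B: "0 \<in> B" "bdd_above B" using \<open>\<not> dominates 0\<close> by (auto simp: B_def)
  have "B \<noteq> {}" using B(1) by blast
  define s where "s = Sup B"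
  have s0: "0 \<le> s" unfolding s_def using B by (rule cSup_upper)
  have s1: "s \<le> 1" unfolding s_def using \<open>B \<noteq> {}\<close> by (rule cSup_least) (simp add: B_def)
  have above: "dominates \<mu>" if "s < \<mu>" "\<mu> \<le> 1" for \<mu>
  proof (rule ccontr)
    assume "\<not> dominates \<mu>"
    then have "\<mu> \<in> B" using that s0 by (simp add: B_def)
    then have "\<mu> \<le> s" unfolding s_def using B(2) by (rule cSup_upper)
    then show False using that by simp
  qed
  have ds: "dominates s"
  proof (cases "s = 1")
    case False
    then show ?thesis using dominates_limit[OF s0 _ above] s1 by simp
  qed (simp add: dominates_one)
  then have "s \<noteq> 0" using \<open>\<not> dominates 0\<close> by auto
  then obtain \<epsilon> where \<epsilon>: "\<epsilon> > 0" "\<And>\<mu>. s - \<epsilon> < \<mu> \<Longrightarrow> \<mu> \<le> s \<Longrightarrow> 0 \<le> \<mu> \<Longrightarrow> dominates \<mu>"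
    using dominates_step[OF _ s1 ds] s0 by (metis order_le_less)
  obtain b where b: "b \<in> B" "s - \<epsilon> < b"
    using less_cSupD[of B "s - \<epsilon>"] \<open>B \<noteq> {}\<close> \<epsilon>(1) unfolding s_def[symmetric] by force
  moreover have "b \<le> s" unfolding s_def using b(1) B(2) by (rule cSup_upper)
  ultimately have "dominates b" using \<epsilon>(2)[of b] by (simp add: B_def)
  then show False using b(1) by (simp add: B_def)
qed

end

section \<open>Radial symmetry\<close>

context emden
begin

text \<open>Two distinct points of equal norm are mirror images in the plane through the origin
  orthogonal to x - y, and \<open>x\<close> is on its upper side because 2 x.(x - y) = |x - y|^2.
  Exchanging the points gives the opposite inequality.\<close>

lemma radial:
  assumes "norm x = norm y" "x \<in> cball 0 1"
  shows "u x = u y"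
proof -
  have le: "u x \<le> u y" if n: "norm x = norm y" and x: "x \<in> cball 0 1" for x y
  proof (cases "x = y")
    case False
    define e where "e = (x - y) /\<^sub>R norm (x - y)"
    interpret moving_plane p u e
      by unfold_locales (use False in \<open>simp add: e_def\<close>)
    have "x \<bullet> x = y \<bullet> y" using n by (simp add: norm_eq)
    then have *: "2 * (x \<bullet> (x - y)) = (x - y) \<bullet> (x - y)"
      by (simp add: algebra_simps inner_commute)
    have xe: "x \<bullet> e = x \<bullet> (x - y) / norm (x - y)"
      by (simp add: e_def divide_inverse mult.commute)
    have "0 \<le> x \<bullet> (x - y)" using * inner_ge_zero[of "x - y"] by linarith
    then have "0 \<le> x \<bullet> e" unfolding xe by simp
    moreover have "reflect e 0 x = y"
    proof -
      have "2 * (x \<bullet> e) = norm (x - y)"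
        using * False by (simp add: xe power2_norm_eq_inner[symmetric] power2_eq_square field_simps)
      then show ?thesis using False by (simp add: reflect_def e_def)
    qed
    ultimately show ?thesis using dominates_zero x by (auto simp: dominates_def)
  qed simp
  show ?thesis using le[OF assms] le[OF assms(1)[symmetric]] assms by simp
qed

end

section \<open>The radial equation\<close>

text \<open>The second-order equation as a system for the profile and its derivative. At the
  singular point 0 it is replaced by continuity and \<open>d 0 = 0\<close>; the endpoint
  \<open>R\<close> is left out so that \<open>v\<close> may vanish there.\<close>

definition emden_ode :: "real \<Rightarrow> real \<Rightarrow> real \<Rightarrow> (real \<Rightarrow> real) \<Rightarrow> (real \<Rightarrow> real) \<Rightarrow> bool" where
  "emden_ode n p R v d \<longleftrightarrow>
     continuous_on {0..<R} v \<and> continuous_on {0..<R} d \<and> d 0 = 0 \<and>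
     (\<forall>r\<in>{0..<R}. 0 < v r) \<and>
     (\<forall>r\<in>{0<..<R}. (v has_real_derivative d r) (at r) \<and>
        (d has_real_derivative - (n - 1) / r * d r - v r powr p) (at r))"

lemma emden_ode_mono:
  "emden_ode n p R v d \<Longrightarrow> R' \<le> R \<Longrightarrow> emden_ode n p R' v d"
  unfolding emden_ode_def by (auto intro: continuous_on_subset)

lemma emden_ode_scale:
  assumes p: "1 < p" and \<mu>: "0 < \<mu>" and ode: "emden_ode n p R v d"
  shows "emden_ode n p (R / \<mu>) (\<lambda>r. \<mu> powr (2 / (p - 1)) * v (\<mu> * r))
           (\<lambda>r. \<mu> powr (2 / (p - 1)) * \<mu> * d (\<mu> * r))"
  unfolding emden_ode_def
proof (intro conjI ballI)
  let ?a = "\<mu> powr (2 / (p - 1))"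
  have sc: "\<mu> * r \<in> {0..<R}" if "r \<in> {0..<R / \<mu>}" for r
    using that \<mu> by (auto simp: field_simps)
  have sub: "(\<lambda>r. \<mu> * r) ` {0..<R / \<mu>} \<subseteq> {0..<R}" using sc by blast
  show "continuous_on {0..<R / \<mu>} (\<lambda>r. ?a * v (\<mu> * r))"
    and "continuous_on {0..<R / \<mu>} (\<lambda>r. ?a * \<mu> * d (\<mu> * r))"
  proof -
    have "continuous_on {0..<R} v" "continuous_on {0..<R} d" using ode by (auto simp: emden_ode_def)
    then have "continuous_on {0..<R / \<mu>} (\<lambda>r. v (\<mu> * r))" "continuous_on {0..<R / \<mu>} (\<lambda>r. d (\<mu> * r))"
      by (auto intro: continuous_on_compose2[OF _ _ sub] continuous_intros)
    then show "continuous_on {0..<R / \<mu>} (\<lambda>r. ?a * v (\<mu> * r))"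
      and "continuous_on {0..<R / \<mu>} (\<lambda>r. ?a * \<mu> * d (\<mu> * r))"
      by (auto intro!: continuous_on_mult_left)
  qed
  show "?a * \<mu> * d (\<mu> * 0) = 0" using ode by (simp add: emden_ode_def)
  show "0 < ?a * v (\<mu> * r)" if "r \<in> {0..<R / \<mu>}" for r
    using sc[OF that] ode \<mu> by (auto simp: emden_ode_def)
  fix r assume r: "r \<in> {0<..<R / \<mu>}"
  then have \<mu>r: "\<mu> * r \<in> {0<..<R}" using \<mu> by (auto simp: field_simps)
  then have dv: "(v has_real_derivative d (\<mu> * r)) (at (\<mu> * r))"
    and dd: "(d has_real_derivative - (n - 1) / (\<mu> * r) * d (\<mu> * r) - v (\<mu> * r) powr p) (at (\<mu> * r))"
    and vpos: "0 < v (\<mu> * r)"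
    using ode by (auto simp: emden_ode_def)
  have l: "((\<lambda>r. \<mu> * r) has_real_derivative \<mu>) (at r)"
    by (auto intro!: derivative_eq_intros)
  show "((\<lambda>r. ?a * v (\<mu> * r)) has_real_derivative ?a * \<mu> * d (\<mu> * r)) (at r)"
    using DERIV_cmult[OF DERIV_chain2[OF dv l], of ?a] by (simp add: mult_ac)
  \<comment> \<open>Since 2p/(p-1) = 2/(p-1) + 2, the power gains exactly the factor
    \<open>\<mu>\<close> squared that two derivatives produce.\<close>
  have "(?a * v (\<mu> * r)) powr p = ?a powr p * v (\<mu> * r) powr p"
    using vpos by (simp add: powr_mult)
  also have "?a powr p = \<mu> powr (2 / (p - 1) + 2)"
    using p by (simp add: powr_powr field_simps)
  also have "\<dots> = ?a * \<mu>\<^sup>2" using \<mu> by (simp add: powr_add)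
  finally have eq: "(?a * v (\<mu> * r)) powr p = ?a * \<mu>\<^sup>2 * v (\<mu> * r) powr p" .
  show "((\<lambda>r. ?a * \<mu> * d (\<mu> * r)) has_real_derivative
      - (n - 1) / r * (?a * \<mu> * d (\<mu> * r)) - (?a * v (\<mu> * r)) powr p) (at r)"
  proof -
    have "?a * \<mu> * ((- (n - 1) / (\<mu> * r) * d (\<mu> * r) - v (\<mu> * r) powr p) * \<mu>)
        = - (n - 1) / r * (?a * \<mu> * d (\<mu> * r)) - (?a * v (\<mu> * r)) powr p"
      unfolding eq using \<mu> r by (simp add: field_simps power2_eq_square)
    then show ?thesis
      using DERIV_cmult[OF DERIV_chain2[OF dd l], of "?a * \<mu>"] by simp
  qed
qed

text \<open>The singular term enters the derivative of the energy \<open>E\<close> with the good sign, so Gronwall's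
  argument works up to \<open>r = 0\<close>.\<close>

lemma emden_ode_unique:
  assumes p: "1 < p" and n: "1 \<le> n"
    and ode: "emden_ode n p R v d" "emden_ode n p R v' d'" and init: "v 0 = v' 0"
    and r: "r \<in> {0..<R}"
  shows "v r = v' r"
proof (cases "r = 0")
  case False
  then have r0: "0 < r" "r < R" using r by auto
  have sub: "{0..r} \<subseteq> {0..<R}" using r0 by auto
  have c: "continuous_on {0..r} v" "continuous_on {0..r} v'" "continuous_on {0..r} d" "continuous_on {0..r} d'"
    using ode sub unfolding emden_ode_def by (blast intro: continuous_on_subset)+
  have "\<exists>x\<in>{0..r}. \<forall>s\<in>{0..r}. v s \<le> v x"
    by (rule continuous_attains_sup[OF _ _ c(1)]) (use r0 in auto)
  then obtain a where a: "\<And>s. s \<in> {0..r} \<Longrightarrow> v s \<le> v a" by blast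
  have "\<exists>x\<in>{0..r}. \<forall>s\<in>{0..r}. v' s \<le> v' x"
    by (rule continuous_attains_sup[OF _ _ c(2)]) (use r0 in auto)
  then obtain b where b: "\<And>s. s \<in> {0..r} \<Longrightarrow> v' s \<le> v' b" by blast
  define M where "M = max (v a) (v' b)"
  define C where "C = p * M powr (p - 1)"
  have C0: "C \<ge> 0" using p by (simp add: C_def)
  have pos: "0 < v s" "0 < v' s" if "s \<in> {0..r}" for s
    using ode that sub by (auto simp: emden_ode_def)
  have lip: "\<bar>v s powr p - v' s powr p\<bar> \<le> C * \<bar>v s - v' s\<bar>" if s: "s \<in> {0..r}" for s
  proof (cases "v s \<le> v' s")
    case True
    then have "v s powr p \<le> v' s powr p" using pos[OF s] p by (intro powr_mono2) auto
    then show ?thesis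
      using powr_diff_le[OF p, of "v s" "v' s" M] pos[OF s] b[OF s] True
      by (simp add: C_def M_def)
  next
    case False
    then have "v' s powr p \<le> v s powr p" using pos[OF s] p by (intro powr_mono2) auto
    then show ?thesis
      using powr_diff_le[OF p, of "v' s" "v s" M] pos[OF s] a[OF s] False
      by (simp add: C_def M_def)
  qed
  define E where "E = (\<lambda>s. (v s - v' s)\<^sup>2 + (d s - d' s)\<^sup>2)"
  \<comment> \<open>The 1 comes from the coupling of \<open>v\<close> and \<open>d\<close>, the
    \<open>C\<close> from the nonlinearity; both mixed terms are absorbed by 2|x||y| <= x^2 +
    y^2.\<close>
  define K where "K = 1 + C"
  have "E r * exp (- K * r) \<le> E 0 * exp (- K * 0)"
  proof (rule DERIV_nonpos_imp_decreasing_open[where f = "\<lambda>s. E s * exp (- K * s)"])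
    show "continuous_on {0..r} (\<lambda>s. E s * exp (- K * s))"
      unfolding E_def by (intro continuous_intros c)
    fix s assume s: "0 < s" "s < r"
    define x y z where "x = v s - v' s" and "y = d s - d' s" and "z = v s powr p - v' s powr p"
    have sR: "s \<in> {0<..<R}" using s r0 by auto
    have dE: "(E has_real_derivative 2 * x * y + 2 * y * (- (n - 1) / s * y - z)) (at s)"
      unfolding E_def x_def y_def z_def
      using ode sR
      by (auto simp: emden_ode_def algebra_simps diff_divide_distrib intro!: derivative_eq_intros)
    have "2 * x * y + 2 * y * (- (n - 1) / s * y - z) \<le> K * (x\<^sup>2 + y\<^sup>2)"
    proof -
      have "0 \<le> (n - 1) / s * y\<^sup>2" using n s by auto
      moreover have "2 * y * (- (n - 1) / s * y - z) = - 2 * ((n - 1) / s * y\<^sup>2) - 2 * y * z"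
        using s by (simp add: field_simps power2_eq_square)
      ultimately have "2 * x * y + 2 * y * (- (n - 1) / s * y - z) \<le> 2 * x * y - 2 * y * z"
        by linarith
      also have "\<dots> \<le> 2 * (\<bar>x\<bar> * \<bar>y\<bar>) + 2 * (\<bar>y\<bar> * \<bar>z\<bar>)"
        by (simp add: abs_mult[symmetric])
      also have "\<dots> \<le> 2 * (\<bar>x\<bar> * \<bar>y\<bar>) + 2 * (\<bar>y\<bar> * (C * \<bar>x\<bar>))"
        using lip[of s] s by (intro add_left_mono mult_left_mono) (auto simp: x_def z_def)
      also have "\<dots> = K * (2 * \<bar>x\<bar> * \<bar>y\<bar>)" by (simp add: K_def algebra_simps)
      also have "\<dots> \<le> K * (x\<^sup>2 + y\<^sup>2)"
        using sum_squares_bound[of "\<bar>x\<bar>" "\<bar>y\<bar>"] C0 by (intro mult_left_mono) (auto simp: K_def)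
      finally show ?thesis .
    qed
    then have "(2 * x * y + 2 * y * (- (n - 1) / s * y - z)) - K * E s \<le> 0"
      by (simp add: E_def x_def y_def)
    then have "((2 * x * y + 2 * y * (- (n - 1) / s * y - z)) - K * E s) * exp (- K * s) \<le> 0"
      by (simp add: mult_le_0_iff)
    moreover have "((\<lambda>s. E s * exp (- K * s)) has_real_derivative
        ((2 * x * y + 2 * y * (- (n - 1) / s * y - z)) - K * E s) * exp (- K * s)) (at s)"
      by (auto intro!: derivative_eq_intros dE simp: algebra_simps)
    ultimately show "\<exists>y. ((\<lambda>s. E s * exp (- K * s)) has_real_derivative y) (at s) \<and> y \<le> 0"
      by blast
  qed (use r0 in auto)
  also have "E 0 = 0" using init ode by (simp add: E_def emden_ode_def)
  finally have "E r \<le> 0" by (simp add: mult_le_0_iff)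
  then have "(v r - v' r)\<^sup>2 \<le> 0" unfolding E_def by (smt (verit) zero_le_power2)
  then show ?thesis by simp
qed (use init in simp)

text \<open>Rescaling the solution with the larger value at \<open>0\<close> gives both the same value there; they then
  coincide, and the rescaled one has its first zero beyond \<open>1\<close>.\<close>

lemma emden_dirichlet_ode_unique:
  assumes p: "1 < p" and n: "1 \<le> n"
    and ode: "emden_ode n p 1 v d" "emden_ode n p 1 v' d'"
    and cont: "continuous_on {0..1} v" "continuous_on {0..1} v'"
    and bdry: "v 1 = 0" "v' 1 = 0" and r: "r \<in> {0..1}"
  shows "v r = v' r"
proof -
  have main: "v r = v' r"
    if ode: "emden_ode n p 1 v d" "emden_ode n p 1 v' d'"
      and cont: "continuous_on {0..1} v"
      and bdry: "v 1 = 0" "v' 1 = 0" and le: "v 0 \<le> v' 0" for v d v' d'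
  proof -
    have pos: "0 < v 0" "0 < v' 0" using ode by (auto simp: emden_ode_def)
    \<comment> \<open>Solves \<open>\<mu>\<close> to the power 2/(p-1) = v(0)/v'(0), which makes the
      initial values agree; the prime here names the second solution.\<close>
    define \<mu> where "\<mu> = (v 0 / v' 0) powr ((p - 1) / 2)"
    have \<mu>: "0 < \<mu>" "\<mu> \<le> 1"
      using pos le p by (auto simp: \<mu>_def intro!: powr_le1)
    define a where "a = \<mu> powr (2 / (p - 1))"
    have a: "a = v 0 / v' 0" 
    proof -
      have "(p - 1) / 2 * (2 / (p - 1)) = 1" using p by simp
      then show ?thesis using pos by (simp only: a_def \<mu>_def powr_powr) simp
    qed
    define z where "z = (\<lambda>r. a * v' (\<mu> * r))"
    have "emden_ode n p (1 / \<mu>) z (\<lambda>r. a * \<mu> * d' (\<mu> * r))"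
      unfolding z_def a_def by (rule emden_ode_scale[OF p \<mu>(1) ode(2)])
    then have zode: "emden_ode n p 1 z (\<lambda>r. a * \<mu> * d' (\<mu> * r))"
      using \<mu> by (elim emden_ode_mono) simp
    have eq: "v s = z s" if "s \<in> {0..<1}" for s
      by (rule emden_ode_unique[OF p n ode(1) zode _ that]) (use pos in \<open>simp add: z_def a\<close>)
    have "\<mu> = 1"
    proof (rule ccontr)
      assume "\<mu> \<noteq> 1"
      then have \<mu>1: "\<mu> < 1" using \<mu> by simp
      have "\<mu> * s \<in> {0..<1}" if "s \<in> {0..1}" for s
      proof -
        have "\<mu> * s \<le> \<mu>" using that \<mu> by (intro mult_left_le) auto
        then have "\<mu> * s < 1" using \<mu>1 by linarith
        then show ?thesis using that \<mu>(1) by simp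
      qed
      then have sub: "(\<lambda>s. \<mu> * s) ` {0..1} \<subseteq> {0..<1}" by blast
      have "continuous_on {0..<1} v'" using ode(2) by (simp add: emden_ode_def)
      then have "continuous_on {0..1} (\<lambda>s. v' (\<mu> * s))"
        by (rule continuous_on_compose2[OF _ _ sub]) (intro continuous_intros)
      then have "continuous_on {0..1} z"
        unfolding z_def by (rule continuous_on_mult_left)
      then have cz: "continuous_on {0..1} (\<lambda>s. v s - z s)"
        using cont by (intro continuous_intros)
      \<comment> \<open>The initial value argument gives agreement only on the half-open interval;
        continuity carries it to the endpoint.\<close>
      have "v 1 - z 1 = 0"
        by (rule continuous_constant_on_closure[of "{0..<1}" "\<lambda>s. v s - z s"])
           (use cz eq in auto)
      moreover have "z 1 > 0" using ode(2) \<mu> \<mu>1 pos by (auto simp: z_def a emden_ode_def)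
      ultimately show False using bdry by simp
    qed
    then have "a = 1" by (simp add: a_def)
    show ?thesis
      using eq[of r] r bdry by (cases "r = 1") (auto simp: z_def \<open>a = 1\<close> \<open>\<mu> = 1\<close>)
  qed
  show ?thesis
  proof (cases "v 0 \<le> v' 0")
    case True
    then show ?thesis using main[OF ode cont(1) bdry] by simp
  next
    case False
    then show ?thesis using main[OF ode(2,1) cont(2) bdry(2,1)] by simp
  qed
qed

section \<open>Passage between solutions in the ball and radial profiles\<close>

context emden
begin

text \<open>Along a diameter the profile is even, so its derivative vanishes at 0. Away from the
  centre the Laplacian of \<open>u\<close> is computed a second time from the profile, and
  uniqueness of pointwise Laplacians equates this with the given one.\<close>

lemma radial_ode:
  assumes e: "norm e = 1"
  shows "\<exists>d. emden_ode (real CARD('n)) p 1 (\<lambda>r. u (r *\<^sub>R e)) d"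
proof -
  have C2: "C2_on (ball 0 1) u" using sol by (simp add: emden_solution_def)
  obtain G H where G: "\<And>x. x \<in> ball 0 1 \<Longrightarrow> (u has_derivative (\<lambda>h. G x \<bullet> h)) (at x)"
    and H: "\<And>x. x \<in> ball 0 1 \<Longrightarrow> (G has_derivative H x) (at x)"
    by (rule that[OF C2_on_hessian(1,2)[OF C2]])
  define v where "v = (\<lambda>r. u (r *\<^sub>R e))"
  define d where "d = (\<lambda>r. G (r *\<^sub>R e) \<bullet> e)"
  define d2 where "d2 = (\<lambda>r. H (r *\<^sub>R e) e \<bullet> e)"
  have mem: "r *\<^sub>R e \<in> ball 0 1" if "\<bar>r\<bar> < 1" for r using that e by simp
  have line: "((\<lambda>r. r *\<^sub>R e) has_derivative (\<lambda>h. h *\<^sub>R e)) (at r)" for r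
    by (auto intro!: derivative_eq_intros)
  have dv: "(v has_real_derivative d r) (at r)" if "\<bar>r\<bar> < 1" for r
    using has_derivative_compose[OF line G[OF mem[OF that]]]
    unfolding v_def d_def
    by (rule has_derivative_imp_has_field_derivative) simp
  have dd: "(d has_real_derivative d2 r) (at r)" if "\<bar>r\<bar> < 1" for r
    using has_derivative_inner_left[OF has_derivative_compose[OF line H[OF mem[OF that]]], of e]
    unfolding d2_def d_def
    by (rule has_derivative_imp_has_field_derivative)
       (simp add: linear_scale[OF has_derivative_linear[OF H[OF mem[OF that]]]])
  have uv: "u y = v (norm y)" if "y \<in> ball 0 1" for y
    using radial[of y "norm y *\<^sub>R e"] that e by (simp add: v_def)
  have d0: "d 0 = 0"
  proof -
    have v_even: "v (- r) = v r" if "\<bar>r\<bar> < 1" for r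
      using radial[of "(- r) *\<^sub>R e" "r *\<^sub>R e"] that e by (simp add: v_def)
    have "(v has_real_derivative d 0) (at (- 0))" using dv[of 0] by simp
    from DERIV_chain2[OF this DERIV_minus[OF DERIV_ident]]
    have "((\<lambda>r. v (- r)) has_real_derivative - d 0) (at 0)" by simp
    then have "(v has_real_derivative - d 0) (at 0)"
      by (rule has_field_derivative_transform_within_open[where S = "{-1<..<1}"])
         (auto simp: v_even)
    then have "- d 0 = d 0" using dv[of 0] DERIV_unique by fastforce
    then show ?thesis by simp
  qed
  have ode: "d2 r = - (real CARD('n) - 1) / r * d r - v r powr p" if r: "0 < r" "r < 1" for r
  proof -
    let ?x = "r *\<^sub>R e"
    have xx: "(?x - 0) \<bullet> (?x - 0) = r\<^sup>2"
      using e by (simp add: norm_eq_1 power2_eq_square)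
    \<comment> \<open>The derivative of v(sqrt s): the profile must be a function of the squared
      norm for \<open>has_lap_sqdist\<close>. The centre is excluded below because the square root
      is not differentiable at 0.\<close>
    define \<phi>' where "\<phi>' = (\<lambda>s. d (sqrt s) / (2 * sqrt s))"
    have sq: "(sqrt has_real_derivative inverse (sqrt s) / 2) (at s)" if "s > 0" for s
      using DERIV_real_sqrt[OF that] by simp
    have d1: "((\<lambda>s. v (sqrt s)) has_real_derivative \<phi>' s) (at s)" if "0 < s" "s < 1" for s
      using DERIV_chain2[OF dv sq, of s] that by (simp add: \<phi>'_def field_simps)
    have "(\<phi>' has_real_derivative ((d2 r * (inverse r / 2)) * (2 * r) - d r * (2 * (inverse r / 2))) / (2 * r * (2 * r))) (at (r\<^sup>2))"
      unfolding \<phi>'_def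
      using DERIV_divide[OF DERIV_chain2[OF dd sq] DERIV_cmult[OF sq, of _ 2], of "r\<^sup>2"] r by simp
    then have d2': "(\<phi>' has_real_derivative (d2 r - d r / r) / (4 * r\<^sup>2)) (at ((?x - 0) \<bullet> (?x - 0)))"
      unfolding xx using r by (simp add: field_simps power2_eq_square)
    have "has_lap (\<lambda>y. v (sqrt ((y - 0) \<bullet> (y - 0)))) ?x
       (4 * ((?x - 0) \<bullet> (?x - 0)) * ((d2 r - d r / r) / (4 * r\<^sup>2)) + 2 * real CARD('n) * \<phi>' ((?x - 0) \<bullet> (?x - 0)))"
    proof (rule has_lap_sqdist[OF _ _ d1 d2'])
      show "open (ball 0 1 - {0} :: (real ^ 'n) set)" by (simp add: open_Diff)
      show "?x \<in> ball 0 1 - {0}" using r e by auto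
      show "0 < (y - 0) \<bullet> (y - 0)" "(y - 0) \<bullet> (y - 0) < 1" if "y \<in> ball 0 1 - {0}" for y :: "real ^ 'n"
        using that mem_ball_iff_inner(1)[of y] by auto
    qed
    moreover have "4 * ((?x - 0) \<bullet> (?x - 0)) * ((d2 r - d r / r) / (4 * r\<^sup>2)) + 2 * real CARD('n) * \<phi>' ((?x - 0) \<bullet> (?x - 0))
        = d2 r + (real CARD('n) - 1) / r * d r"
      unfolding xx using r by (simp add: \<phi>'_def field_simps)
    ultimately have "has_lap (\<lambda>y. v (sqrt ((y - 0) \<bullet> (y - 0)))) ?x (d2 r + (real CARD('n) - 1) / r * d r)"
      by simp
    then have "has_lap u ?x (d2 r + (real CARD('n) - 1) / r * d r)"
      by (rule has_lap_transform[where S = "ball 0 1"])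
         (use mem[of r] r uv in \<open>auto simp: norm_eq_sqrt_inner\<close>)
    from has_lap_unique[OF this lap[OF mem]] r show ?thesis
      by (simp add: v_def field_simps)
  qed
  have "continuous_on {0..<1} v" "continuous_on {0..<1} d"
    by (auto intro!: continuous_at_imp_continuous_on DERIV_isCont[OF dv] DERIV_isCont[OF dd])
  moreover have "0 < v r" if "r \<in> {0..<1}" for r
    unfolding v_def by (rule pos[OF mem]) (use that in auto)
  moreover have "(v has_real_derivative d r) (at r)" if "r \<in> {0<..<1}" for r
    using dv[of r] that by auto
  moreover have "(d has_real_derivative - (real CARD('n) - 1) / r * d r - v r powr p) (at r)"
    if "r \<in> {0<..<1}" for r
    using dd[of r] ode[of r] that by auto
  ultimately have "emden_ode (real CARD('n)) p 1 v d"
    using d0 unfolding emden_ode_def by blast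
  then show ?thesis unfolding v_def by blast
qed

end

lemma emden_solution_unique:
  fixes u u' :: "real ^ 'n::finite \<Rightarrow> real"
  assumes p: "1 < p" and sol: "emden_solution p u" "emden_solution p u'" and x: "x \<in> cball 0 1"
  shows "u x = u' x"
proof -
  interpret u: emden p u by unfold_locales (use p sol in auto)
  interpret u': emden p u' by unfold_locales (use p sol in auto)
  define e :: "real ^ 'n" where "e = axis undefined 1"
  have e: "norm e = 1" by (simp add: e_def)
  obtain d where d: "emden_ode (real CARD('n)) p 1 (\<lambda>r. u (r *\<^sub>R e)) d"
    using u.radial_ode[OF e] by blast
  obtain d' where d': "emden_ode (real CARD('n)) p 1 (\<lambda>r. u' (r *\<^sub>R e)) d'"
    using u'.radial_ode[OF e] by blast
  have c: "continuous_on {0..1} (\<lambda>r. u (r *\<^sub>R e))" "continuous_on {0..1} (\<lambda>r. u' (r *\<^sub>R e))"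
    by (auto intro!: continuous_intros continuous_on_compose2[OF u.cont] continuous_on_compose2[OF u'.cont]
        simp: e)
  have b: "u (1 *\<^sub>R e) = 0" "u' (1 *\<^sub>R e) = 0"
    using u.bdry[of e] u'.bdry[of e] e by auto
  have "1 \<le> real CARD('n)" by (simp add: Suc_le_eq)
  from emden_dirichlet_ode_unique[OF p this d d' c b, of "norm x"] x
  have "u (norm x *\<^sub>R e) = u' (norm x *\<^sub>R e)" by simp
  moreover have "u x = u (norm x *\<^sub>R e)" "u' x = u' (norm x *\<^sub>R e)"
    by (rule u.radial u'.radial; use x e in simp)+
  ultimately show ?thesis by simp
qed

text \<open>In divergence form the derivative of r^(n-1) d is - r^(n-1) v^p, without a singular
  term, so l'Hopital's rule applies against r^n. The limit is the second derivative of the profile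
  at the centre.\<close>

lemma emden_ode_slope_limit:
  assumes n: "2 \<le> n" and ode: "emden_ode (real n) p R v d" and R: "0 < R"
  shows "((\<lambda>r. d r / r) \<longlongrightarrow> - (v 0 powr p) / real n) (at_right 0)"
proof -
  define k where "k = n - 1"
  have k: "n = Suc k" "k > 0" using n by (auto simp: k_def)
  have ev: "\<forall>\<^sub>F r in at_right 0. 0 < r \<and> r < R"
    using eventually_at_right_less[of 0] eventually_at_right_real[OF R] by eventually_elim auto
  have c: "continuous_on {0..<R} v" "continuous_on {0..<R} d" "d 0 = 0" "0 < v 0"
    using ode R by (auto simp: emden_ode_def)
  have right: "(f \<longlongrightarrow> f 0) (at_right 0)" if "continuous_on {0..<R} f" for f :: "real \<Rightarrow> real"
  proof -
    have "continuous_on {0..R/2} f" using that by (rule continuous_on_subset) (use R in auto)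
    then have "(f \<longlongrightarrow> f 0) (at 0 within {0..R/2})" using R by (simp add: continuous_on)
    then show ?thesis using R by (simp add: at_within_Icc_at_right)
  qed
  have "((\<lambda>r. (r ^ k * d r) / r ^ n) \<longlongrightarrow> - (v 0 powr p) / real n) (at_right 0)"
  proof (rule lhopital_right_0)
    show "((\<lambda>r. r ^ k * d r) \<longlongrightarrow> 0) (at_right 0)"
      using tendsto_mult[OF tendsto_power[OF tendsto_ident_at, of k 0 "{0<..}"] right[OF c(2)]] c(3) by simp
    show "((\<lambda>r::real. r ^ n) \<longlongrightarrow> 0) (at_right 0)"
      using tendsto_power[OF tendsto_ident_at, of n "0::real" "{0<..}"] k by simp
    show "\<forall>\<^sub>F r in at_right 0. (r::real) ^ n \<noteq> 0"
      using ev by eventually_elim auto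
    show "\<forall>\<^sub>F r in at_right 0. real n * r ^ k \<noteq> 0"
      using ev by eventually_elim (use n in auto)
    show "\<forall>\<^sub>F r in at_right 0. ((\<lambda>r. r ^ k * d r) has_real_derivative - (r ^ k * v r powr p)) (at r)"
      using ev
    proof eventually_elim
      case (elim r)
      then have "(d has_real_derivative - (real n - 1) / r * d r - v r powr p) (at r)"
        using ode by (auto simp: emden_ode_def)
      from DERIV_mult[OF DERIV_power[OF DERIV_ident, of k] this]
      have "((\<lambda>r. r ^ k * d r) has_real_derivative
        real k * r ^ (k - 1) * d r + (- (real n - 1) / r * d r - v r powr p) * r ^ k) (at r)"
        by simp
      moreover have "real k * r ^ (k - 1) * d r + (- (real n - 1) / r * d r - v r powr p) * r ^ k = - (r ^ k * v r powr p)"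
        using k elim by (cases k) (auto simp: field_simps)
      ultimately show ?case by simp
    qed
    show "\<forall>\<^sub>F r in at_right 0. ((\<lambda>r. r ^ n) has_real_derivative real n * r ^ k) (at r)"
      using DERIV_pow[of n] k(1) by (intro always_eventually allI) simp
    have "((\<lambda>r. - (v r powr p) / real n) \<longlongrightarrow> - (v 0 powr p) / real n) (at_right 0)"
      using right[OF c(1)] c(4) n by (intro tendsto_intros) auto
    moreover have "\<forall>\<^sub>F r in at_right 0. - (v r powr p) / real n = - (r ^ k * v r powr p) / (real n * r ^ k)"
      using ev by eventually_elim (use n in \<open>simp add: field_simps\<close>)
    ultimately show "((\<lambda>r. - (r ^ k * v r powr p) / (real n * r ^ k)) \<longlongrightarrow> - (v 0 powr p) / real n) (at_right 0)"
      by (rule Lim_transform_eventually)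
  qed
  moreover have "\<forall>\<^sub>F r in at_right 0. (r ^ k * d r) / r ^ n = d r / r"
    using ev by eventually_elim (simp add: k)
  ultimately show ?thesis by (rule Lim_transform_eventually)
qed

text \<open>The gradient is q(|x|) x with q = d/r, extended continuously to 0. The equation gives q'
  = - c/r with c = n q + v^p, and c(0) = 0. This makes the rank-one part of the Hessian continuous
  at the centre, so the function is C^2 there; the trace is - c + n q = - v^p.\<close>

lemma emden_solution_radialI:
  fixes u :: "real ^ 'n::finite \<Rightarrow> real"
  assumes n: "2 \<le> CARD('n)" and ode: "emden_ode (real CARD('n)) p 1 v d"
    and cont: "continuous_on {0..1} v" and bdry: "v 1 = 0"
    and u: "\<And>x. x \<in> cball 0 1 \<Longrightarrow> u x = v (norm x)"
  shows "emden_solution p u"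
proof -
  let ?B = "ball 0 1 :: (real ^ 'n) set"
  define n where "n = real CARD('n)"
  have n0: "n > 0" by (simp add: n_def)
  have ode': "emden_ode n p 1 v d" using ode by (simp add: n_def)
  define q where "q = (\<lambda>r. if r = 0 then - (v 0 powr p) / n else d r / r)"
  define c where "c = (\<lambda>r. n * q r + v r powr p)"
  define G where "G = (\<lambda>x::real ^ 'n. q (norm x) *\<^sub>R x)"
  \<comment> \<open>At \<open>x = 0\<close> the first summand of \<open>H\<close> vanishes because of \<open>1 / 0 = 0\<close>, as it should.\<close>
  define H where "H = (\<lambda>x::real ^ 'n. \<lambda>h.
     (- c (norm x) / (norm x)\<^sup>2) *\<^sub>R ((x \<bullet> h) *\<^sub>R x) + q (norm x) *\<^sub>R h)"
  have cv: "continuous_on {0..<1} v" and cd: "continuous_on {0..<1} d" and d0: "d 0 = 0"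
    and vpos: "\<And>r. r \<in> {0..<1} \<Longrightarrow> 0 < v r"
    and dv: "\<And>r. r \<in> {0<..<1} \<Longrightarrow> (v has_real_derivative d r) (at r)"
    and dd: "\<And>r. r \<in> {0<..<1} \<Longrightarrow> (d has_real_derivative - (n - 1) / r * d r - v r powr p) (at r)"
    using ode' by (auto simp: emden_ode_def)
  have dq: "(q has_real_derivative - c r / r) (at r)" if r: "r \<in> {0<..<1}" for r
  proof -
    have "((\<lambda>r. d r / r) has_real_derivative
        ((- (n - 1) / r * d r - v r powr p) * r - d r * 1) / (r * r)) (at r)"
      using r by (intro DERIV_divide dd DERIV_ident) auto
    also have "((- (n - 1) / r * d r - v r powr p) * r - d r * 1) / (r * r) = - c r / r"
      using r by (simp add: c_def q_def field_simps)
    finally show ?thesis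
      by (rule has_field_derivative_transform_within_open[where S = "{0<..<1}"])
         (use r in \<open>auto simp: q_def\<close>)
  qed
  have cq: "continuous_on {0..<1} q"
    unfolding continuous_on_eq_continuous_within
  proof
    fix r :: real assume r: "r \<in> {0..<1}"
    show "continuous (at r within {0..<1}) q"
    proof (cases "r = 0")
      case True
      have "((\<lambda>r. d r / r) \<longlongrightarrow> q 0) (at_right 0)"
        using emden_ode_slope_limit[OF n ode] by (simp add: q_def n_def)
      moreover have "\<forall>\<^sub>F r in at_right 0. d r / r = q r"
        using eventually_at_right_less[of "0::real"] by eventually_elim (simp add: q_def)
      ultimately have "(q \<longlongrightarrow> q 0) (at_right 0)"
        by (rule Lim_transform_eventually)
      then have "(q \<longlongrightarrow> q 0) (at 0 within {0..1})"
        by (simp add: at_within_Icc_at_right)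
      then have "(q \<longlongrightarrow> q 0) (at 0 within {0..<1})"
        by (rule tendsto_within_subset) auto
      then show ?thesis by (simp add: True continuous_within)
    next
      case False
      then have "r \<in> {0<..<1}" using r by simp
      from DERIV_isCont[OF dq[OF this]] show ?thesis
        by (rule continuous_at_imp_continuous_at_within)
    qed
  qed
  have cc: "continuous_on {0..<1} c"
    unfolding c_def using cv vpos
    by (intro continuous_intros cq) (auto simp: less_imp_neq[symmetric])
  have c0: "c 0 = 0" using n0 by (simp add: c_def q_def)
  have norm_img: "norm ` ?B \<subseteq> {0..<1}" by auto
  have cont_norm: "continuous_on ?B (\<lambda>x. f (norm x))" if "continuous_on {0..<1} f" for f :: "real \<Rightarrow> real"
    by (rule continuous_on_compose2[OF that continuous_on_norm[OF continuous_on_id] norm_img])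
  have isCont_norm: "isCont (\<lambda>x. f (norm x)) x" if "continuous_on {0..<1} f" "x \<in> ?B"
    for f :: "real \<Rightarrow> real" and x
    using cont_norm[OF that(1)] that(2) unfolding continuous_on_eq_continuous_at[OF open_ball] by blast
  have lim0: "((\<lambda>x::real ^ 'n. f (norm x)) \<longlongrightarrow> f 0) (at 0)" if "continuous_on {0..<1} f" for f :: "real \<Rightarrow> real"
    using isCont_norm[OF that, of 0] by (simp add: isCont_def)
  have small: "\<exists>\<delta>>0. \<forall>x::real ^ 'n. norm x < \<delta> \<longrightarrow> \<bar>f (norm x) - f 0\<bar> < \<epsilon>"
    if "continuous_on {0..<1} f" "\<epsilon> > 0" for f :: "real \<Rightarrow> real" and \<epsilon>
    using isCont_norm[OF that(1), of 0] that(2)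
    unfolding continuous_at_eps_delta by (simp add: dist_real_def)
  have uG: "(u has_derivative (\<lambda>h. G x \<bullet> h)) (at x)" if x: "x \<in> ?B" for x
  proof -
    have "((\<lambda>x. v (norm x)) has_derivative (\<lambda>h. G x \<bullet> h)) (at x)"
    proof (cases "x = 0")
      case False
      then have r: "norm x \<in> {0<..<1}" using x by auto
      show ?thesis
        using has_derivative_compose[OF has_derivative_norm[OF False] dv[OF r, unfolded has_field_derivative_def]]
          False by (simp add: G_def q_def sgn_div_norm inner_commute divide_inverse mult_ac)
    next
      case True
      \<comment> \<open>The norm is not differentiable at 0, so the increment is estimated directly:
        the mean value theorem bounds it by |y| times a small value of \<open>d\<close>.\<close>
      have "((\<lambda>x::real ^ 'n. v (norm x)) has_derivative (\<lambda>h. 0)) (at 0)"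
        unfolding has_derivative_at_alt
      proof (intro conjI allI impI)
        fix \<epsilon> :: real assume "\<epsilon> > 0"
        then obtain \<delta> where \<delta>: "\<delta> > 0" "\<And>x::real ^ 'n. norm x < \<delta> \<Longrightarrow> \<bar>d (norm x)\<bar> < \<epsilon>"
          using small[OF cd] d0 by auto
        show "\<exists>\<delta>>0. \<forall>y. norm (y - 0) < \<delta> \<longrightarrow>
          norm (v (norm y) - v (norm (0 :: real ^ 'n)) - 0) \<le> \<epsilon> * norm (y - 0 :: real ^ 'n)"
        proof (intro exI[of _ "min \<delta> 1"] conjI allI impI)
          fix y :: "real ^ 'n" assume y: "norm (y - 0) < min \<delta> 1"
          show "norm (v (norm y) - v (norm (0 :: real ^ 'n)) - 0) \<le> \<epsilon> * norm (y - 0)"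
          proof (cases "y = 0")
            case False
            then have y0: "0 < norm y" by simp
            have "continuous_on {0..norm y} v" by (rule continuous_on_subset[OF cv]) (use y in auto)
            moreover have "v differentiable (at s)" if "0 < s" "s < norm y" for s
              using dv[of s] that y real_differentiable_def by auto
            ultimately obtain l s where s: "0 < s" "s < norm y" "DERIV v s :> l"
              "v (norm y) - v 0 = (norm y - 0) * l"
              using MVT[OF y0] by blast
            have "l = d s" using dv[of s] s y DERIV_unique by auto
            have "\<bar>d s\<bar> < \<epsilon>"
              \<comment> \<open>The smallness of \<open>d\<close> is stated for norms of vectors, so
                the radius \<open>s\<close> is realised on an axis.\<close>
              using \<delta>(2)[of "s *\<^sub>R axis undefined 1"] s y by simp
            then show ?thesis
              using s(4) \<open>l = d s\<close> y0 by (simp add: abs_mult mult.commute)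
          qed simp
        qed (use \<delta> in auto)
      qed simp
      then show ?thesis by (simp add: True G_def)
    qed
    then show ?thesis
      by (rule has_derivative_transform_within_open[where s = ?B]) (use x u in auto)
  qed
  have GH: "(G has_derivative H x) (at x)" if x: "x \<in> ?B" for x
  proof (cases "x = 0")
    case False
    then have r: "norm x \<in> {0<..<1}" using x by auto
    have "((\<lambda>x. q (norm x)) has_derivative (\<lambda>h. - c (norm x) / norm x * (h \<bullet> sgn x))) (at x)"
      using has_derivative_compose[OF has_derivative_norm[OF False] dq[OF r, unfolded has_field_derivative_def]] .
    from has_derivative_scaleR[OF this has_derivative_ident]
    have "(G has_derivative (\<lambda>h. q (norm x) *\<^sub>R h + (- c (norm x) / norm x * (h \<bullet> sgn x)) *\<^sub>R x)) (at x)"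
      unfolding G_def .
    moreover have "(\<lambda>h. q (norm x) *\<^sub>R h + (- c (norm x) / norm x * (h \<bullet> sgn x)) *\<^sub>R x) = H x"
      by (rule ext) (simp add: H_def sgn_div_norm inner_commute power2_eq_square divide_inverse)
    ultimately show ?thesis by simp
  next
    case True
    have "(G has_derivative (\<lambda>h. q 0 *\<^sub>R h)) (at 0)"
      unfolding has_derivative_at_alt
    proof (intro conjI allI impI)
      fix \<epsilon> :: real assume "\<epsilon> > 0"
      then obtain \<delta> where \<delta>: "\<delta> > 0" "\<And>x::real ^ 'n. norm x < \<delta> \<Longrightarrow> \<bar>q (norm x) - q 0\<bar> < \<epsilon>"
        using small[OF cq] by auto
      show "\<exists>\<delta>>0. \<forall>y. norm (y - 0) < \<delta> \<longrightarrow> norm (G y - G 0 - q 0 *\<^sub>R (y - 0)) \<le> \<epsilon> * norm (y - 0)"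
      proof (intro exI[of _ \<delta>] conjI allI impI)
        fix y :: "real ^ 'n" assume "norm (y - 0) < \<delta>"
        then have "\<bar>q (norm y) - q 0\<bar> * norm y \<le> \<epsilon> * norm y"
          using \<delta>(2)[of y] by (intro mult_right_mono) auto
        moreover have "G y - G 0 - q 0 *\<^sub>R (y - 0) = (q (norm y) - q 0) *\<^sub>R y"
          by (simp add: G_def scaleR_diff_left)
        ultimately show "norm (G y - G 0 - q 0 *\<^sub>R (y - 0)) \<le> \<epsilon> * norm (y - 0)" by simp
      qed (use \<delta> in auto)
    qed (simp add: bounded_linear_scaleR_right)
    then show ?thesis by (simp add: True H_def)
  qed
  have cH: "continuous_on ?B (\<lambda>x. H x (axis j 1))" for j
  proof -
    let ?e = "axis j 1 :: real ^ 'n"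
    let ?T = "\<lambda>x. (- c (norm x) / (norm x)\<^sup>2) *\<^sub>R ((x \<bullet> ?e) *\<^sub>R x)"
    have "isCont ?T x" if x: "x \<in> ?B" for x
    proof (cases "x = 0")
      case False
      have "isCont (\<lambda>x. c (norm x)) x"
        by (rule isCont_norm[OF cc x])
      then show ?thesis using False by (intro continuous_intros) auto
    next
      case True
      \<comment> \<open>The quotient by |x|^2 is compensated by the two factors \<open>x\<close>,
        which leaves |c(|x|)|, and this tends to c(0) = 0.\<close>
      have "(?T \<longlongrightarrow> 0) (at 0)"
      proof (rule Lim_null_comparison)
        show "\<forall>\<^sub>F x in at 0. norm (?T x) \<le> \<bar>c (norm x)\<bar>"
        proof (rule always_eventually, rule allI)
          fix x :: "real ^ 'n"
          show "norm (?T x) \<le> \<bar>c (norm x)\<bar>"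
          proof (cases "x = 0")
            case False
            have "\<bar>x \<bullet> ?e\<bar> \<le> norm x" using Cauchy_Schwarz_ineq2[of x ?e] by simp
            then have "\<bar>x \<bullet> ?e\<bar> * norm x \<le> (norm x)\<^sup>2"
              by (simp add: power2_eq_square mult_right_mono)
            then have "\<bar>c (norm x)\<bar> / (norm x)\<^sup>2 * (\<bar>x \<bullet> ?e\<bar> * norm x) \<le> \<bar>c (norm x)\<bar> / (norm x)\<^sup>2 * (norm x)\<^sup>2"
              by (intro mult_left_mono) auto
            then show ?thesis using False by (simp add: abs_mult mult_ac)
          qed simp
        qed
        show "((\<lambda>x::real ^ 'n. \<bar>c (norm x)\<bar>) \<longlongrightarrow> 0) (at 0)"
          using tendsto_rabs[OF lim0[OF cc]] c0 by simp
      qed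
      then show ?thesis by (simp add: True isCont_def)
    qed
    then have "continuous_on ?B ?T" by (simp add: continuous_at_imp_continuous_on)
    from continuous_on_add[OF this continuous_on_scaleR[OF cont_norm[OF cq] continuous_on_const[of _ ?e]]]
    show ?thesis unfolding H_def .
  qed
  have "laplacian u x = trace (matrix (H x))" if "x \<in> ?B" for x
    using C2_onI(2)[OF open_ball uG GH cH that] by blast
  moreover have "trace (matrix (H x)) = - (v (norm x) powr p)" for x
  proof -
    have "trace (matrix (H x)) = (- c (norm x) / (norm x)\<^sup>2) * (x \<bullet> x) + q (norm x) * n"
      unfolding H_def n_def
      by (simp only: trace_matrix_add trace_matrix_scale trace_matrix_rank1 trace_matrix_ident)
    also have "(- c (norm x) / (norm x)\<^sup>2) * (x \<bullet> x) = - c (norm x)"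
      using c0 by (cases "x = 0") (auto simp: power2_norm_eq_inner)
    finally show ?thesis by (simp add: c_def mult.commute)
  qed
  moreover have "C2_on ?B u" using C2_onI(1)[OF open_ball uG GH cH] .
  moreover have "continuous_on (cball 0 1) u"
  proof (rule continuous_on_eq)
    show "continuous_on (cball 0 1) (\<lambda>x::real ^ 'n. v (norm x))"
      by (rule continuous_on_compose2[OF cont continuous_on_norm[OF continuous_on_id]]) auto
  qed (use u in auto)
  moreover have "0 < u x" if "x \<in> ?B" for x using that u vpos by simp
  moreover have "u x = 0" if "x \<in> sphere 0 1" for x using that u bdry by simp
  ultimately show ?thesis using u unfolding emden_solution_def by simp
qed

section \<open>Existence for the radial equation\<close>

text \<open>With \<open>k = N - 1\<close>, the function \<open>v = 1 - potential k g\<close> solves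
  \<open>v'' + (k / r) v' + g = 0\<close>, \<open>v(0) = 1\<close>, \<open>v'(0) = 0\<close>. The value \<open>slope k g 0 = 0\<close> is the right one, although
  it comes from \<open>0 / 0 = 0\<close>.\<close>

definition flux :: "nat \<Rightarrow> (real \<Rightarrow> real) \<Rightarrow> real \<Rightarrow> real" where
  "flux k g r = integral {0..r} (\<lambda>t. t ^ k * g t)"

definition slope :: "nat \<Rightarrow> (real \<Rightarrow> real) \<Rightarrow> real \<Rightarrow> real" where
  "slope k g r = flux k g r / r ^ k"

definition potential :: "nat \<Rightarrow> (real \<Rightarrow> real) \<Rightarrow> real \<Rightarrow> real" where
  "potential k g r = integral {0..r} (slope k g)"

section \<open>Calculus and estimates for flux, slope and potential\<close>

lemma continuous_on_flux_integrand:
  fixes g :: "real \<Rightarrow> real"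
  shows "continuous_on {0..R} g \<Longrightarrow> continuous_on {0..R} (\<lambda>t. t ^ k * g t)"
  by (auto intro!: continuous_intros)

lemma flux_has_derivative:
  assumes "continuous_on {0..R} g" "r \<in> {0..R}"
  shows "(flux k g has_real_derivative r ^ k * g r) (at r within {0..R})"
  using integral_has_real_derivative[OF continuous_on_flux_integrand[OF assms(1), of k] assms(2)]
  by (simp add: flux_def[abs_def])

lemma integral_power_bound:
  fixes g :: "real \<Rightarrow> real"
  assumes r: "0 \<le> r" and g: "continuous_on {0..r} g"
    and bound: "\<And>t. t \<in> {0..r} \<Longrightarrow> \<bar>g t\<bar> \<le> c * t ^ m"
  shows "\<bar>integral {0..r} g\<bar> \<le> c * r ^ Suc m / real (Suc m)"
proof -
  have "((\<lambda>t. c * t ^ m) has_integral c * r ^ Suc m / real (Suc m) - c * 0 ^ Suc m / real (Suc m)) {0..r}"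
    by (rule fundamental_theorem_of_calculus[OF r])
       (auto intro!: derivative_eq_intros simp: has_real_derivative_iff_has_vector_derivative[symmetric]
          simp del: power_Suc of_nat_Suc)
  then have hi: "((\<lambda>t. c * t ^ m) has_integral c * r ^ Suc m / real (Suc m)) {0..r}" by simp
  have "norm (integral {0..r} g) \<le> integral {0..r} (\<lambda>t. c * t ^ m)"
    by (rule integral_norm_bound_integral)
       (use g hi bound in \<open>auto intro: integrable_continuous_real has_integral_integrable\<close>)
  then show ?thesis using integral_unique[OF hi] by simp
qed

text \<open>The factor 1/(k+m+1) from the integration is given up, which leaves a bound independent
  of the dimension. The denominators that make the iteration converge come from the second
  integration, in \<open>potential_bound\<close>.\<close>

lemma slope_bound:
  assumes r: "0 \<le> r" and g: "continuous_on {0..r} g"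
    and bound: "\<And>t. t \<in> {0..r} \<Longrightarrow> \<bar>g t\<bar> \<le> c * t ^ m" and c: "0 \<le> c"
  shows "\<bar>slope k g r\<bar> \<le> c * r ^ Suc m"
proof (cases "r = 0")
  case True
  then show ?thesis using c by (cases k) (auto simp: slope_def flux_def)
next
  case False
  have "\<bar>flux k g r\<bar> \<le> c * r ^ Suc (k + m) / real (Suc (k + m))"
    unfolding flux_def
  proof (rule integral_power_bound[OF r])
    show "continuous_on {0..r} (\<lambda>t. t ^ k * g t)" using g by (intro continuous_intros)
    show "\<bar>t ^ k * g t\<bar> \<le> c * t ^ (k + m)" if "t \<in> {0..r}" for t
      using mult_left_mono[OF bound[OF that], of "t ^ k"] that
      by (simp add: abs_mult power_add mult_ac)
  qed
  also have "\<dots> \<le> c * r ^ Suc (k + m)"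
    using c r by (simp add: divide_le_eq mult_left_le) (simp add: algebra_simps mult_left_le)
  also have "\<dots> = c * r ^ Suc m * r ^ k" by (simp add: power_add mult_ac)
  finally show ?thesis using False r by (simp add: slope_def divide_le_eq abs_mult power_abs)
qed

text \<open>Only the centre needs an argument: there the bounded \<open>g\<close> makes the slope at
  most a constant times r.\<close>

lemma continuous_on_slope:
  assumes g: "continuous_on {0..R} g"
  shows "continuous_on {0..R} (slope k g)"
proof (cases "R > 0")
  case True
  have "\<exists>b\<in>{0..R}. \<forall>t\<in>{0..R}. \<bar>g t\<bar> \<le> \<bar>g b\<bar>"
    by (rule continuous_attains_sup) (use True g in \<open>auto intro!: continuous_intros\<close>)
  then obtain c where c: "\<And>t. t \<in> {0..R} \<Longrightarrow> \<bar>g t\<bar> \<le> c" by blast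
  have c0: "0 \<le> c" using c[of 0] True by simp
  show ?thesis
    unfolding continuous_on_eq_continuous_within
  proof
    fix r assume r: "r \<in> {0..R}"
    show "continuous (at r within {0..R}) (slope k g)"
    proof (cases "r = 0")
      case False
      have "continuous (at r within {0..R}) (flux k g)"
        using flux_has_derivative[OF g r] by (rule DERIV_continuous)
      then show ?thesis
        unfolding slope_def[abs_def] using False by (intro continuous_intros) auto
    next
      case True
      have s0: "slope k g 0 = 0" by (cases k) (auto simp: slope_def flux_def)
      have "(slope k g \<longlongrightarrow> 0) (at 0 within {0..R})"
      proof (rule Lim_null_comparison)
        show "\<forall>\<^sub>F t in at 0 within {0..R}. norm (slope k g t) \<le> c * t"
          unfolding eventually_at_filter
        proof (intro always_eventually allI impI)
          fix t assume "t \<in> {0..R}"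
          then show "norm (slope k g t) \<le> c * t"
            using slope_bound[of t g c 0 k] c c0 continuous_on_subset[OF g, of "{0..t}"] by auto
        qed
        have "((\<lambda>t. c * t) \<longlongrightarrow> c * 0) (at 0 within {0..R})" by (intro tendsto_intros)
        then show "((\<lambda>t. c * t) \<longlongrightarrow> 0) (at 0 within {0..R})" by simp
      qed
      then show ?thesis by (simp add: True continuous_within s0)
    qed
  qed
next
  case False
  then have "{0..R} \<subseteq> {0}" by auto
  then show ?thesis using continuous_on_subset[OF continuous_on_sing] by blast
qed

lemma potential_has_derivative:
  assumes "continuous_on {0..R} g" "r \<in> {0..R}"
  shows "(potential k g has_real_derivative slope k g r) (at r within {0..R})"
  using integral_has_real_derivative[OF continuous_on_slope[OF assms(1)] assms(2), of k]
  by (simp add: potential_def[abs_def])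

lemma continuous_on_potential:
  assumes "continuous_on {0..R} g"
  shows "continuous_on {0..R} (potential k g)"
  using potential_has_derivative[OF assms] by (meson DERIV_continuous_on)

lemma potential_bound:
  assumes r: "0 \<le> r" and g: "continuous_on {0..r} g"
    and bound: "\<And>t. t \<in> {0..r} \<Longrightarrow> \<bar>g t\<bar> \<le> c * t ^ m" and c: "0 \<le> c"
  shows "\<bar>potential k g r\<bar> \<le> c * r ^ (m + 2) / real (m + 2)"
proof -
  have "\<bar>integral {0..r} (slope k g)\<bar> \<le> c * r ^ Suc (Suc m) / real (Suc (Suc m))"
  proof (rule integral_power_bound[OF r continuous_on_slope[OF g]])
    show "\<bar>slope k g t\<bar> \<le> c * t ^ Suc m" if "t \<in> {0..r}" for t
      by (rule slope_bound) (use that bound c in \<open>auto intro: continuous_on_subset[OF g]\<close>)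
  qed
  then show ?thesis by (simp add: potential_def)
qed

lemma potential_diff:
  assumes g: "continuous_on {0..r} g" and h: "continuous_on {0..r} h"
  shows "potential k g r - potential k h r = potential k (\<lambda>t. g t - h t) r"
proof -
  have "slope k g s - slope k h s = slope k (\<lambda>t. g t - h t) s" if "s \<in> {0..r}" for s
  proof -
    have "continuous_on {0..s} g" "continuous_on {0..s} h"
      using that continuous_on_subset[OF g] continuous_on_subset[OF h] by auto
    then have "flux k g s - flux k h s = flux k (\<lambda>t. g t - h t) s"
      unfolding flux_def right_diff_distrib
      by (intro integral_diff[symmetric] integrable_continuous_real continuous_on_flux_integrand)
    then show ?thesis by (simp add: slope_def diff_divide_distrib[symmetric])
  qed
  then have "integral {0..r} (\<lambda>s. slope k g s - slope k h s) = potential k (\<lambda>t. g t - h t) r"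
    unfolding potential_def by (rule integral_cong)
  then show ?thesis
    unfolding potential_def
    by (subst integral_diff[symmetric])
       (auto intro!: integrable_continuous_real continuous_on_slope g h)
qed

text \<open>Successive iterates differ by at most L^j r^(2j+2) / j!, which is summable for every
  \<open>R\<close>. So the iteration converges uniformly on an interval of any length, where a
  contraction argument in the supremum norm would require a short one.\<close>

lemma radial_picard:
  fixes f :: "real \<Rightarrow> real"
  assumes lip: "\<And>a b. \<bar>f a - f b\<bar> \<le> L * \<bar>a - b\<bar>" and f1: "\<And>a. \<bar>f a\<bar> \<le> 1"
  shows "\<exists>v. continuous_on {0..R} v \<and> (\<forall>r\<in>{0..R}. v r = 1 - potential k (\<lambda>t. f (v t)) r)"
proof -
  have L: "0 \<le> L" using lip[of 0 1] by simp
  have "L-lipschitz_on UNIV f"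
    using lip L by (auto simp: lipschitz_on_def dist_real_def)
  then have cf: "continuous_on UNIV f" by (rule lipschitz_on_continuous_on)
  have cfg: "continuous_on S (\<lambda>t. f (g t))" if "continuous_on S g" for S :: "real set" and g
    by (rule continuous_on_compose2[OF cf that]) simp
  define h where "h = rec_nat (\<lambda>r. 1) (\<lambda>j g r. 1 - potential k (\<lambda>t. f (g t)) r)"
  have h0: "h 0 = (\<lambda>r. 1)" and hS: "h (Suc j) = (\<lambda>r. 1 - potential k (\<lambda>t. f (h j t)) r)" for j
    by (simp_all add: h_def)
  have ch: "continuous_on {0..r} (h j)" for j r
  proof (induction j)
    case (Suc j)
    then show ?case unfolding hS by (intro continuous_intros continuous_on_potential cfg)
  qed (simp add: h0)
  have bound: "\<bar>h (Suc j) r - h j r\<bar> \<le> L ^ j / fact j * r ^ (2 * j + 2)" if "0 \<le> r" for j r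
    using that
  proof (induction j arbitrary: r)
    case 0
    have "\<bar>potential k (\<lambda>t. f 1) r\<bar> \<le> 1 * r ^ (0 + 2) / real (0 + 2)"
      by (rule potential_bound) (use 0 f1 in auto)
    also have "\<dots> \<le> r ^ 2" by (simp add: power2_eq_square)
    finally show ?case by (simp add: hS h0 power2_eq_square)
  next
    case (Suc j)
    have "h (Suc (Suc j)) r - h (Suc j) r
        = potential k (\<lambda>t. f (h j t)) r - potential k (\<lambda>t. f (h (Suc j) t)) r"
      by (subst (1 2) hS) simp
    also have "\<dots> = potential k (\<lambda>t. f (h j t) - f (h (Suc j) t)) r"
      by (intro potential_diff cfg ch)
    also have "\<bar>\<dots>\<bar> \<le> (L * (L ^ j / fact j)) * r ^ (2 * j + 2 + 2) / real (2 * j + 2 + 2)"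
    proof (rule potential_bound[OF Suc.prems])
      show "continuous_on {0..r} (\<lambda>t. f (h j t) - f (h (Suc j) t))"
        by (intro continuous_intros cfg ch)
      show "\<bar>f (h j t) - f (h (Suc j) t)\<bar> \<le> L * (L ^ j / fact j) * t ^ (2 * j + 2)" if "t \<in> {0..r}" for t
      proof -
        have "\<bar>f (h j t) - f (h (Suc j) t)\<bar> \<le> L * \<bar>h (Suc j) t - h j t\<bar>"
          using lip by (simp add: abs_minus_commute)
        also have "\<dots> \<le> L * (L ^ j / fact j * t ^ (2 * j + 2))"
          by (rule mult_left_mono[OF Suc.IH L]) (use that in auto)
        finally show ?thesis by (simp add: mult_ac)
      qed
      show "0 \<le> L * (L ^ j / fact j)" using L by simp
    qed
    also have "\<dots> = L ^ Suc j / (fact j * real (2 * j + 2 + 2)) * r ^ (2 * Suc j + 2)"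
      by simp
    \<comment> \<open>Of the denominator 2j + 4 only the part j + 1 is kept, to form the next
      factorial.\<close>
    also have "\<dots> \<le> L ^ Suc j / fact (Suc j) * r ^ (2 * Suc j + 2)"
    proof (intro mult_right_mono divide_left_mono)
      have "fact (Suc j) = fact j * real (Suc j)" by (simp add: mult.commute)
      also have "\<dots> \<le> fact j * real (2 * j + 2 + 2)" by (intro mult_left_mono) auto
      finally show "(fact (Suc j) :: real) \<le> fact j * real (2 * j + 2 + 2)" .
    qed (use L Suc.prems in \<open>auto simp del: fact_Suc\<close>)
    finally show ?case .
  qed
  define M where "M = (\<lambda>j. R\<^sup>2 * (inverse (fact j) * (L * R\<^sup>2) ^ j))"
  have "uniform_limit {0..R} (\<lambda>n x. \<Sum>i<n. h (Suc i) x - h i x)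
      (\<lambda>x. \<Sum>i. h (Suc i) x - h i x) sequentially"
  proof (rule Weierstrass_m_test)
    show "summable M" unfolding M_def by (intro summable_mult summable_exp)
    fix j x assume x: "x \<in> {0..R}"
    have "\<bar>h (Suc j) x - h j x\<bar> \<le> L ^ j / fact j * x ^ (2 * j + 2)" using bound x by simp
    also have "\<dots> \<le> L ^ j / fact j * R ^ (2 * j + 2)"
      using L x by (intro mult_left_mono power_mono) auto
    also have "R ^ (2 * j + 2) = R\<^sup>2 * (R\<^sup>2) ^ j" 
      by (subst power_add, subst power_mult) (rule mult.commute)
    also have "L ^ j / fact j * (R\<^sup>2 * (R\<^sup>2) ^ j) = M j"
      by (simp add: M_def power_mult_distrib divide_inverse mult_ac)
    finally show "norm (h (Suc j) x - h j x) \<le> M j" by simp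
  qed
  moreover have "(\<Sum>i<n. h (Suc i) x - h i x) = h n x - 1" for n x
    by (subst sum_lessThan_telescope) (simp add: h0)
  ultimately have ul: "uniform_limit {0..R} (\<lambda>n x. h n x - 1) (\<lambda>x. \<Sum>i. h (Suc i) x - h i x) sequentially"
    by simp
  define v where "v = (\<lambda>x. (\<Sum>i. h (Suc i) x - h i x) + 1)"
  have uv: "uniform_limit {0..R} h v sequentially"
    using uniform_limit_add[OF ul uniform_limit_const[where c = "\<lambda>x. 1"]] by (simp add: v_def)
  have cv: "continuous_on {0..R} v"
    by (rule uniform_limit_theorem[OF _ uv]) (auto simp: ch)
  have "v r = 1 - potential k (\<lambda>t. f (v t)) r" if r: "r \<in> {0..R}" for r
  proof (rule LIMSEQ_unique)
    show "(\<lambda>j. h (Suc j) r) \<longlonglongrightarrow> v r"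
      by (intro LIMSEQ_Suc tendsto_uniform_limitI[OF uv r])
    have cvr: "continuous_on {0..r} v" by (rule continuous_on_subset[OF cv]) (use r in auto)
    have "(\<lambda>j. potential k (\<lambda>t. f (h j t)) r) \<longlonglongrightarrow> potential k (\<lambda>t. f (v t)) r"
    proof (rule LIMSEQ_I)
      fix \<epsilon> :: real assume \<epsilon>: "\<epsilon> > 0"
      define \<delta> where "\<delta> = \<epsilon> / (1 + L * R\<^sup>2)"
      have LR: "0 \<le> L * R\<^sup>2" using L by simp
      have \<delta>: "\<delta> > 0" unfolding \<delta>_def using \<epsilon> LR by (intro divide_pos_pos) auto
      obtain n0 where n0: "\<And>j x. j \<ge> n0 \<Longrightarrow> x \<in> {0..R} \<Longrightarrow> \<bar>h j x - v x\<bar> < \<delta>"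
        using uv \<delta> unfolding uniform_limit_sequentially_iff dist_real_def by metis
      show "\<exists>n0. \<forall>j\<ge>n0. norm (potential k (\<lambda>t. f (h j t)) r - potential k (\<lambda>t. f (v t)) r) < \<epsilon>"
      proof (intro exI[of _ n0] allI impI)
        fix j assume j: "j \<ge> n0"
        have "\<bar>potential k (\<lambda>t. f (h j t) - f (v t)) r\<bar> \<le> (L * \<delta>) * r ^ (0 + 2) / real (0 + 2)"
        proof (rule potential_bound)
          show "continuous_on {0..r} (\<lambda>t. f (h j t) - f (v t))"
            by (intro continuous_intros cfg ch cvr)
          show "\<bar>f (h j t) - f (v t)\<bar> \<le> L * \<delta> * t ^ 0" if "t \<in> {0..r}" for t
            using lip[of "h j t" "v t"] mult_left_mono[OF less_imp_le[OF n0[OF j, of t]] L] that r by simp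
        qed (use r L \<delta> in auto)
        also have "\<dots> \<le> (L * \<delta>) * R\<^sup>2"
        proof -
          have "(L * \<delta>) * r\<^sup>2 \<le> (L * \<delta>) * R\<^sup>2"
            using r L \<delta> by (intro mult_left_mono power_mono) auto
          moreover have "0 \<le> (L * \<delta>) * r\<^sup>2" using L \<delta> by simp
          moreover have "(L * \<delta>) * r ^ (0 + 2) / real (0 + 2) = (L * \<delta>) * r\<^sup>2 / 2"
            by (simp add: power2_eq_square)
          ultimately show ?thesis by linarith
        qed
        also have "\<dots> < (1 + L * R\<^sup>2) * \<delta>" using \<delta> by (simp add: algebra_simps)
        also have "\<dots> = \<epsilon>" using LR by (simp add: \<delta>_def)
        finally show "norm (potential k (\<lambda>t. f (h j t)) r - potential k (\<lambda>t. f (v t)) r) < \<epsilon>"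
          by (subst potential_diff) (auto intro: cfg ch cvr)
      qed
    qed
    then show "(\<lambda>j. h (Suc j) r) \<longlonglongrightarrow> 1 - potential k (\<lambda>t. f (v t)) r"
      unfolding hS by (intro tendsto_intros)
  qed
  with cv show ?thesis by blast
qed

text \<open>A globally Lipschitz replacement of the nonlinearity that does not affect solutions with
  values between 0 and 1.\<close>

definition clipped_power :: "real \<Rightarrow> real \<Rightarrow> real" where
  "clipped_power p y = (max 0 (min 1 y)) powr p"

lemma clipped_power_lipschitz:
  assumes p: "1 < p"
  shows "\<bar>clipped_power p a - clipped_power p b\<bar> \<le> p * \<bar>a - b\<bar>"
proof -
  have le: "\<bar>clipped_power p a - clipped_power p b\<bar> \<le> p * \<bar>a - b\<bar>" if "a \<le> b" for a b
  proof -
    let ?a = "max 0 (min 1 a)" and ?b = "max 0 (min 1 b)"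
    have ab: "?a \<le> ?b" "?b - ?a \<le> b - a" using that by auto
    have "clipped_power p a \<le> clipped_power p b"
      unfolding clipped_power_def using ab(1) p by (intro powr_mono2) auto
    moreover have "clipped_power p b - clipped_power p a \<le> p * (?b - ?a)"
      using powr_diff_le[OF p _ ab(1), of 1] by (simp add: clipped_power_def)
    moreover have "p * (?b - ?a) \<le> p * (b - a)" using ab(2) p by (intro mult_left_mono) auto
    ultimately have "clipped_power p b - clipped_power p a \<le> p * (b - a)" by linarith
    then show ?thesis using that \<open>clipped_power p a \<le> clipped_power p b\<close> by simp
  qed
  show ?thesis
    using le[of a b] le[of b a] by (cases "a \<le> b") (auto simp: abs_minus_commute)
qed

lemma clipped_power_bounds: "0 < p \<Longrightarrow> 0 \<le> clipped_power p y \<and> clipped_power p y \<le> 1"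
  by (auto simp: clipped_power_def intro!: powr_le1)

lemma flux_lower_bound:
  assumes r: "0 \<le> r" and g: "continuous_on {0..r} g" and m: "\<And>t. t \<in> {0..r} \<Longrightarrow> m \<le> g t"
  shows "m * r ^ Suc k / real (Suc k) \<le> flux k g r"
proof -
  have "((\<lambda>t. m * t ^ k) has_integral m * r ^ Suc k / real (Suc k) - m * 0 ^ Suc k / real (Suc k)) {0..r}"
    by (rule fundamental_theorem_of_calculus[OF r])
       (auto intro!: derivative_eq_intros simp: has_real_derivative_iff_has_vector_derivative[symmetric]
          simp del: power_Suc of_nat_Suc)
  then have hi: "((\<lambda>t. m * t ^ k) has_integral m * r ^ Suc k / real (Suc k)) {0..r}" by simp
  show ?thesis
    unfolding flux_def
  proof (rule has_integral_le[OF hi integrable_integral])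
    show "(\<lambda>t. t ^ k * g t) integrable_on {0..r}"
      by (intro integrable_continuous_real continuous_on_flux_integrand g)
    show "m * t ^ k \<le> t ^ k * g t" if "t \<in> {0..r}" for t
      using mult_left_mono[OF m[OF that], of "t ^ k"] that by (simp add: mult.commute)
  qed
qed

lemma flux_mono:
  assumes "0 \<le> a" "a \<le> b" and g: "continuous_on {0..b} g" and "\<And>t. t \<in> {0..b} \<Longrightarrow> 0 \<le> g t"
  shows "flux k g a \<le> flux k g b"
  unfolding flux_def
proof (rule integral_subset_le)
  show "(\<lambda>t. t ^ k * g t) integrable_on {0..b}"
    by (intro integrable_continuous_real continuous_on_flux_integrand g)
  have "continuous_on {0..a} g" by (rule continuous_on_subset[OF g]) (use assms in auto)
  then show "(\<lambda>t. t ^ k * g t) integrable_on {0..a}"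
    by (intro integrable_continuous_real continuous_on_flux_integrand)
qed (use assms in auto)

lemma slope_zero: "slope k g 0 = 0"
  by (cases k) (auto simp: slope_def flux_def)

lemma slope_has_derivative:
  assumes g: "continuous_on {0..R} g" and r: "r \<in> {0<..<R}"
  shows "(slope k g has_real_derivative g r - real k / r * slope k g r) (at r)"
proof -
  have at_eq: "at r within {0..R} = at r"
    by (rule at_within_interior) (use r in simp)
  have "(flux k g has_real_derivative r ^ k * g r) (at r)"
    using flux_has_derivative[OF g, of r k] r unfolding at_eq by simp
  from DERIV_divide[OF this DERIV_pow[of k r]] r
  have "((\<lambda>r. flux k g r / r ^ k) has_real_derivative
      (r ^ k * g r * r ^ k - flux k g r * (real k * r ^ (k - Suc 0))) / (r ^ k * r ^ k)) (at r)"
    by simp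
  moreover have "(r ^ k * g r * r ^ k - flux k g r * (real k * r ^ (k - Suc 0))) / (r ^ k * r ^ k)
      = g r - real k / r * slope k g r"
  proof (cases k)
    case (Suc m)
    have "r > 0" using r by simp
    then show ?thesis by (simp add: slope_def Suc divide_simps) (simp add: algebra_simps)
  qed (simp add: slope_def)
  ultimately show ?thesis by (simp add: slope_def[abs_def])
qed

section \<open>Existence of a first zero\<close>

lemma powr_eventually_large:
  fixes s B :: real
  assumes "0 < s"
  shows "\<exists>x\<ge>1. B < x powr s"
proof -
  have "B < (max 1 (B + 1)) powr 1" by simp
  also have "\<dots> = ((max 1 (B + 1)) powr (1 / s)) powr s"
    using assms by (simp add: powr_powr)
  finally show ?thesis
    using assms by (intro exI[of _ "(max 1 (B + 1)) powr (1 / s)"]) (auto intro: ge_one_powr_ge_zero)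
qed

text \<open>The length \<open>R\<close> is fixed in advance, so large that the clipped solution
  cannot stay positive on it. Up to its first zero this solution has values between 0 and 1, where
  clipping changes nothing.\<close>

lemma emden_ode_with_zero:
  assumes n: "2 \<le> n" and p: "1 < p" and crit: "(real n - 2) * (p - 1) < 2"
  shows "\<exists>R v d. 0 < R \<and> emden_ode (real n) p R v d \<and> continuous_on {0..R} v \<and> v R = 0"
proof -
  define k where "k = n - 1"
  have k: "n = Suc k" "k > 0" using n by (auto simp: k_def)
  have nk: "real n = real k + 1" using k by simp
  \<comment> \<open>Equals (p-1) times the difference of the decay exponents 2/(p-1) and n-2;
    \<open>crit\<close> says that it is positive.\<close>
  define s where "s = 2 - (real k - 1) * (p - 1)"
  have s: "s > 0" using crit by (simp add: s_def nk)
  \<comment> \<open>A lower bound for the flux at radius 1: the potential is at most 1/2 on [0,1],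
    so \<open>v\<close> is at least 1/2 there.\<close>
  define c where "c = (1/2) powr p / real n"
  have c: "c > 0" using n by (simp add: c_def)
  define A where "A = (c / 2 ^ k) powr (1 - p)"
  obtain \<rho> where \<rho>: "1 \<le> \<rho>" "A * (2 * real n / (p - 1)) < \<rho> powr s"
    using powr_eventually_large[OF s] by blast
  \<comment> \<open>\<open>\<rho>\<close> violates the inequality that positivity would imply. The
    second half of the interval is needed for the lower bound at \<open>\<rho>\<close>, obtained
    from the decrease of \<open>v\<close> between \<open>\<rho>\<close> and
    2\<open>\<rho>\<close>.\<close>
  define R where "R = 2 * \<rho>"
  have R: "R \<ge> 2" using \<rho> by (simp add: R_def)
  obtain v where cv: "continuous_on {0..R} v"
    and v: "\<And>r. r \<in> {0..R} \<Longrightarrow> v r = 1 - potential k (\<lambda>t. clipped_power p (v t)) r"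
    using radial_picard[of "clipped_power p" p R k] clipped_power_lipschitz[OF p] clipped_power_bounds[of p] p
    by auto
  define g where "g = (\<lambda>t. clipped_power p (v t))"
  define d where "d = (\<lambda>r. - slope k g r)"
  have cg: "continuous_on {0..R} g"
    unfolding g_def clipped_power_def using p cv
    by (intro continuous_on_powr' continuous_intros) auto
  have g01: "0 \<le> g t" "g t \<le> 1" for t
    using clipped_power_bounds[of p "v t"] p by (auto simp: g_def)
  have cgr: "continuous_on {0..r} g" if "r \<le> R" for r
    by (rule continuous_on_subset[OF cg]) (use that in auto)
  have cvr: "continuous_on {a..b} v" if "0 \<le> a" "b \<le> R" for a b
    by (rule continuous_on_subset[OF cv]) (use that in auto)
  have v0: "v 0 = 1" using v[of 0] R by (simp add: potential_def)
  have dv: "(v has_real_derivative d r) (at r)" if r: "r \<in> {0<..<R}" for r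
  proof -
    have "(potential k g has_real_derivative slope k g r) (at r)"
      using potential_has_derivative[OF cg, of r k] r at_within_interior[of r "{0..R}"] by simp
    from DERIV_diff[OF DERIV_const[of 1] this]
    have "((\<lambda>r. 1 - potential k g r) has_real_derivative d r) (at r)" by (simp add: d_def)
    then show ?thesis
      by (rule has_field_derivative_transform_within_open[where S = "{0<..<R}"])
         (use r v in \<open>auto simp: g_def\<close>)
  qed
  have dd: "(d has_real_derivative - (real n - 1) / r * d r - g r) (at r)" if "r \<in> {0<..<R}" for r
    using DERIV_minus[OF slope_has_derivative[OF cg that, of k]] by (simp add: d_def nk)
  have flux0: "0 \<le> flux k g r" if "r \<in> {0..R}" for r
    using flux_lower_bound[of r g 0 k] that cgr g01 by simp
  have d0: "d r \<le> 0" if "r \<in> {0..R}" for r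
    using flux0[OF that] that by (simp add: d_def slope_def)
  have v_anti: "v b \<le> v a" if "0 \<le> a" "a \<le> b" "b \<le> R" for a b
  proof (rule DERIV_nonpos_imp_decreasing_open[OF that(2)])
    show "\<exists>y. (v has_real_derivative y) (at x) \<and> y \<le> 0" if "a < x" "x < b" for x
      using dv[of x] d0[of x] that \<open>0 \<le> a\<close> \<open>b \<le> R\<close> by auto
    show "continuous_on {a..b} v" using that by (intro cvr)
  qed
  have v1: "v r \<le> 1" if "r \<in> {0..R}" for r using v_anti[of 0 r] that v0 by simp
  have g_pow: "g r = v r powr p" if "r \<in> {0..R}" "0 \<le> v r" for r
    using v1[OF that(1)] that(2) by (simp add: g_def clipped_power_def)
  have flux1: "c \<le> flux k g 1"
  proof -
    have "(1/2) powr p \<le> g t" if t: "t \<in> {0..1}" for t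
    proof -
      have "\<bar>potential k g t\<bar> \<le> 1 * t ^ (0 + 2) / real (0 + 2)"
        by (rule potential_bound) (use t cgr[of t] R g01 in auto)
      moreover have "t\<^sup>2 \<le> 1" using t by (simp add: power_le_one)
      ultimately have "1/2 \<le> v t" using v[of t] t R by (simp add: g_def power2_eq_square)
      then have "(1/2) powr p \<le> v t powr p" using p by (intro powr_mono2) auto
      then show ?thesis using g_pow[of t] t R \<open>1/2 \<le> v t\<close> by simp
    qed
    then show ?thesis
      using flux_lower_bound[of 1 g "(1/2) powr p" k] cgr[of 1] R by (simp add: c_def k(1))
  qed
  \<comment> \<open>A positive solution would decay at least like \<open>r\<close> to the power \<open>-2/(p-1)\<close> and at most like \<open>r\<close>
    to the power \<open>2-N\<close>; this is where \<open>p < N/(N-2)\<close> enters.\<close>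
  have "\<exists>r\<in>{0..R}. v r \<le> 0"
  proof (rule ccontr)
    assume "\<not> (\<exists>r\<in>{0..R}. v r \<le> 0)"
    then have vpos: "0 < v r" if "r \<in> {0..R}" for r using that by force
    have \<rho>R: "\<rho> \<in> {0..R}" "0 < \<rho>" "\<rho> < R" using \<rho> by (auto simp: R_def)
    have upper: "1 \<le> v \<rho> powr (1 - p) - (p - 1) / (2 * real n) * \<rho>\<^sup>2"
    proof -
      \<comment> \<open>As \<open>v\<close> decreases, the flux is at least v^p r^n / n, hence - v'
        >= v^p r / n. Dividing by v^p and integrating bounds v^(1-p) below by a multiple of r^2;
        \<open>W\<close> is the difference of the two sides and does not decrease.\<close>
      define W where "W = (\<lambda>r. v r powr (1 - p) - (p - 1) / (2 * real n) * r\<^sup>2)"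
      have "W 0 \<le> W \<rho>"
      proof (rule DERIV_nonneg_imp_increasing_open[where f = W])
        show "continuous_on {0..\<rho>} W"
          unfolding W_def using vpos \<rho>R
          by (intro continuous_intros cvr) (auto simp: less_imp_neq[symmetric])
        fix r assume r: "0 < r" "r < \<rho>"
        then have rR: "r \<in> {0<..<R}" "r \<in> {0..R}" using \<rho>R by auto
        have vr: "0 < v r" by (rule vpos[OF rR(2)])
        have "(W has_real_derivative (1 - p) * v r powr (1 - p - 1) * d r - (p - 1) / real n * r) (at r)"
          unfolding W_def using vr n by (auto intro!: derivative_eq_intros dv[OF rR(1)])
        moreover have "0 \<le> (1 - p) * v r powr (1 - p - 1) * d r - (p - 1) / real n * r"
        proof -
          have "v r powr p * r ^ Suc k / real (Suc k) \<le> flux k g r"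
          proof (rule flux_lower_bound)
            show "v r powr p \<le> g t" if "t \<in> {0..r}" for t
            proof -
              have "v r \<le> v t" using v_anti[of t r] that rR by auto
              then have "v r powr p \<le> v t powr p" using vr p by (intro powr_mono2) auto
              then show ?thesis using g_pow[of t] vpos[of t] that rR by (simp add: less_imp_le)
            qed
          qed (use r rR cgr in auto)
          then have "v r powr p * r / real n \<le> - d r"
            using r by (simp add: d_def slope_def k(1) field_simps)
          then have "(p - 1) * v r powr (- p) * (v r powr p * r / real n) \<le> (p - 1) * v r powr (- p) * - d r"
            using p by (intro mult_left_mono) auto
          moreover have "v r powr (- p) * v r powr p = 1"
            using vr by (simp add: powr_add[symmetric])
          then have "(p - 1) * v r powr (- p) * (v r powr p * r / real n) = (p - 1) / real n * r"
            by (simp add: mult.assoc[symmetric])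
          ultimately show ?thesis by (simp add: algebra_simps)
        qed
        ultimately show "\<exists>y. (W has_real_derivative y) (at r) \<and> 0 \<le> y" by blast
      qed (use \<rho>R in auto)
      then show ?thesis by (simp add: W_def v0)
    qed
    \<comment> \<open>Beyond radius 1 the flux is at least \<open>c\<close>, so - v' is at least c /
      R^k between \<open>\<rho>\<close> and \<open>R\<close>. Since \<open>v R\<close> is positive,
      \<open>v \<rho>\<close> exceeds the whole drop over that interval.\<close>
    have lower: "c / 2 ^ k * \<rho> powr (1 - real k) \<le> v \<rho>"
    proof -
      have "\<exists>l z. \<rho> < z \<and> z < R \<and> (v has_real_derivative l) (at z) \<and> v R - v \<rho> = (R - \<rho>) * l"
      proof (rule MVT[OF \<rho>R(3)])
        show "continuous_on {\<rho>..R} v" by (rule cvr) (use \<rho>R in auto)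
        show "v differentiable (at x)" if "\<rho> < x" "x < R" for x
          using dv[of x] that \<rho>R real_differentiable_def by auto
      qed
      then obtain l z where z: "\<rho> < z" "z < R" "(v has_real_derivative l) (at z)" "v R - v \<rho> = \<rho> * l"
        by (auto simp: R_def)
      have "l = d z" using dv[of z] z \<rho>R DERIV_unique by auto
      have "c \<le> flux k g z" using flux1 flux_mono[of 1 z g k] z \<rho> cgr[of z] g01 by simp
      then have "c / R ^ k \<le> flux k g z / z ^ k"
        using z \<rho> c by (intro frac_le power_mono) auto
      then have "\<rho> * (c / R ^ k) \<le> \<rho> * - l"
        using \<rho>R unfolding \<open>l = d z\<close> d_def slope_def by (intro mult_left_mono) auto
      also have "\<dots> \<le> v \<rho>" using z(4) vpos[of R] R by simp
      finally have "\<rho> * (c / R ^ k) \<le> v \<rho>" .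
      moreover have "\<rho> * (c / R ^ k) = c / 2 ^ k * \<rho> powr (1 - real k)"
        using \<rho>R by (simp add: R_def powr_diff powr_realpow power_mult_distrib)
      ultimately show ?thesis by simp
    qed
    have "(p - 1) / (2 * real n) * \<rho>\<^sup>2 \<le> v \<rho> powr (1 - p)" using upper by linarith
    \<comment> \<open>The exponent 1 - p is negative, so the lower bound for \<open>v \<rho>\<close>
      becomes an upper bound for its power.\<close>
    also have "\<dots> \<le> (c / 2 ^ k * \<rho> powr (1 - real k)) powr (1 - p)"
      using lower p c \<rho>R by (intro powr_mono2') auto
    also have "\<dots> = A * \<rho> powr ((1 - real k) * (1 - p))"
      using c \<rho>R by (subst powr_mult) (auto simp: A_def powr_powr)
    finally have "(p - 1) / (2 * real n) * \<rho>\<^sup>2 \<le> A * \<rho> powr ((1 - real k) * (1 - p))" .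
    moreover have "\<rho>\<^sup>2 = \<rho> powr s * \<rho> powr ((1 - real k) * (1 - p))"
    proof -
      have "s + (1 - real k) * (1 - p) = 2" by (simp add: s_def algebra_simps)
      then show ?thesis using \<rho>R by (simp add: powr_add[symmetric])
    qed
    ultimately have "(p - 1) / (2 * real n) * \<rho> powr s * \<rho> powr ((1 - real k) * (1 - p))
        \<le> A * \<rho> powr ((1 - real k) * (1 - p))" by (simp add: mult.assoc)
    then have "(p - 1) / (2 * real n) * \<rho> powr s \<le> A"
      by (rule mult_right_le_imp_le) (use \<rho>R in simp)
    then have "\<rho> powr s \<le> A * (2 * real n / (p - 1))"
      using p n by (simp add: field_simps)
    then show False using \<rho>(2) by simp
  qed
  then have ne: "{0..R} \<inter> v -` {..0} \<noteq> {}" by auto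
  have "closed ({0..R} \<inter> v -` {..0})"
    by (rule continuous_closed_preimage[OF cv]) auto
  then have "compact ({0..R} \<inter> v -` {..0})"
    by (simp add: compact_eq_bounded_closed bounded_Int)
  then obtain r0 where r0: "r0 \<in> {0..R}" "v r0 \<le> 0" "\<And>r. r \<in> {0..R} \<Longrightarrow> v r \<le> 0 \<Longrightarrow> r0 \<le> r"
    using compact_attains_inf[OF _ ne] by auto
  have r0p: "0 < r0" using r0 v0 by (cases "r0 = 0") auto
  have vpos: "0 < v r" if "r \<in> {0..<r0}" for r
    using r0(3)[of r] that r0(1) by (force simp: not_le[symmetric])
  have "v r0 = 0"
  proof -
    obtain x where "0 \<le> x" "x \<le> r0" "v x = 0"
      using IVT2'[of v r0 0 0] r0 v0 cvr[of 0 r0] by auto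
    then show ?thesis using r0(3)[of x] r0(1) by simp
  qed
  moreover have "emden_ode (real n) p r0 v d"
    unfolding emden_ode_def
  proof (intro conjI ballI)
    show "continuous_on {0..<r0} v" by (rule continuous_on_subset[OF cv]) (use r0(1) in auto)
    have "continuous_on {0..R} d" unfolding d_def by (intro continuous_intros continuous_on_slope cg)
    then show "continuous_on {0..<r0} d" by (rule continuous_on_subset) (use r0(1) in auto)
    show "d 0 = 0" by (simp add: d_def slope_zero)
    fix r assume r: "r \<in> {0<..<r0}"
    then have rR: "r \<in> {0<..<R}" using r0(1) by auto
    show "(v has_real_derivative d r) (at r)" by (rule dv[OF rR])
    have "g r = v r powr p" using g_pow[of r] vpos[of r] r rR by auto
    then show "(d has_real_derivative - (real n - 1) / r * d r - v r powr p) (at r)"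
      using dd[OF rR] by simp
  qed (use vpos in auto)
  ultimately show ?thesis using r0p cvr[of 0 r0] r0(1) by auto
qed

section \<open>The Emden problem in the unit ball\<close>

lemma emden_solution_exists:
  assumes n: "2 \<le> CARD('n::finite)" and p: "1 < p" and crit: "(real CARD('n) - 2) * (p - 1) < 2"
  shows "\<exists>u :: real ^ 'n \<Rightarrow> real. u \<in> extensional (cball 0 1) \<and> emden_solution p u"
proof -
  obtain R v d where R: "0 < R" and ode: "emden_ode (real CARD('n)) p R v d"
    and cv: "continuous_on {0..R} v" and vR: "v R = 0"
    using emden_ode_with_zero[OF n p crit] by blast
  define w where "w = (\<lambda>r. R powr (2 / (p - 1)) * v (R * r))"
  have "continuous_on {0..1} (\<lambda>r. v (R * r))"
    by (rule continuous_on_compose2[OF cv]) (use R in \<open>auto intro!: continuous_intros simp: mult_left_le\<close>)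
  then have "continuous_on {0..1} w"
    unfolding w_def by (rule continuous_on_mult_left)
  moreover have "emden_ode (real CARD('n)) p 1 w (\<lambda>r. R powr (2 / (p - 1)) * R * d (R * r))"
    using emden_ode_scale[OF p R ode] R by (simp add: w_def)
  moreover have "w 1 = 0" by (simp add: w_def vR)
  ultimately have "emden_solution p (restrict (\<lambda>x::real ^ 'n. w (norm x)) (cball 0 1))"
    by (intro emden_solution_radialI[OF n]) auto
  then show ?thesis by (intro exI[of _ "restrict (\<lambda>x::real ^ 'n. w (norm x)) (cball 0 1)"]) simp
qed

theorem theorem5p1:
  fixes p :: real
  assumes "CARD('n::finite) \<ge> 2"
    and "1 < p" and "ereal p < critical_exponent CARD('n)"
  shows "\<exists>!u :: real ^ 'n \<Rightarrow> real. u \<in> extensional (cball 0 1) \<and> emden_solution p u"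
proof -
  \<comment> \<open>The condition p < N/(N-2) cleared of its denominator. For N = 2 it reads 0 < 2,
    so the two cases of the critical exponent merge.\<close>
  have "(real CARD('n) - 2) * (p - 1) < 2"
  proof (cases "CARD('n) = 2")
    case False
    then have N: "real CARD('n) - 2 > 0" using assms(1) by linarith
    then have "p < real CARD('n) / (real CARD('n) - 2)"
      using assms(3) False by (simp add: critical_exponent_def)
    then show ?thesis using N by (simp add: field_simps)
  qed simp
  from emden_solution_exists[OF assms(1,2) this]
  obtain u :: "real ^ 'n \<Rightarrow> real" where u: "u \<in> extensional (cball 0 1)" "emden_solution p u"
    by blast
  show ?thesis
  proof (rule ex1I)
    show "u \<in> extensional (cball 0 1) \<and> emden_solution p u" using u by blast
    fix u' :: "real ^ 'n \<Rightarrow> real"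
    assume u': "u' \<in> extensional (cball 0 1) \<and> emden_solution p u'"
    \<comment> \<open>Solutions are unique on the closed ball, and extensionality fixes all values
      outside it.\<close>
    show "u' = u"
      by (rule extensionalityI[of _ "cball 0 1"])
         (use u u' emden_solution_unique[OF assms(2)] in auto)
  qed
qed

end
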